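(* Let $A=\mathbb{C}_\lambda[S^2]$ be the unit fuzzy sphere with its 3D differential calculus with central basis $s^1,s^2,s^3$, let $g=g_{ij}s^i\otimes s^j$ be a quantum metric, where $(g_{ij})$ is a real symmetric invertible $3\times3$ matrix, and let $\nabla$ be the quantum Levi-Civita connection $\nabla s^i=-\tfrac12\Gamma^i{}_{jk}s^j\otimes s^k$ with $\Gamma_{ijk}:=g_{im}\Gamma^m{}_{jk}=2\epsilon_{ikm}g_{mj}+\mathrm{Tr}(g)\epsilon_{ijk}$. Then the Ricci scalar curvature $S$ of $\nabla$ is $$S=\frac{\tfrac12\left(\mathrm{Tr}(g^2)-\tfrac12\mathrm{Tr}(g)^2\right)}{\det(g)}.$$
   Context: Repeated indices in $\{1,2,3\}$ are summed; $\epsilon_{ijk}$ is the totally antisymmetric symbol with $\epsilon_{123}=1$; $\imath=\sqrt{-1}$; $\lambda_p$ is a real parameter with $\lambda_p\neq 0,\pm1$. Algebra. $A=\mathbb{C}_\lambda[S^2]$ is the unital $*$-algebra over $\mathbb{C}$ generated by self-adjoint $x_1,x_2,x_3$ with relations $[x_i,x_j]=2\imath\lambda_p\epsilon_{ijk}x_k$ and $\sum_i x_i^2=1-\lambda_p^2$. Calculus. $\Omega^1$ is the $A$-bimodule that is free as a left module with basis $s^1,s^2,s^3$ and with $[s^i,x_j]=0$. The map $\mathrm{d}:A\to\Omega^1$ is the derivation with $\mathrm{d}x_i=\epsilon_{ijk}x_js^k$. The exterior algebra $\Omega$ is generated over $A$ by the central $s^i$ with $s^i\wedge s^j+s^j\wedge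 s^i=0$, and $\mathrm{d}s^i=-\tfrac12\epsilon_{ijk}s^j\wedge s^k$, with $\mathrm{d}$ extended by the graded Leibniz rule. Metric. $g=g_{ij}s^i\otimes s^j\in\Omega^1\otimes_A\Omega^1$; its inverse is the bimodule map $(\ ,\ ):\Omega^1\otimes_A\Omega^1\to A$ with $(s^i,s^j)=g^{ij}$, where $(g^{ij})$ is the inverse matrix of $(g_{ij})$. $\mathrm{Tr}$ and $\det$ are those of the matrix $(g_{ij})$. Connection. A left connection is a linear map $\nabla:\Omega^1\to\Omega^1\otimes_A\Omega^1$ with $\nabla(a\omega)=\mathrm{d}a\otimes\omega+a\nabla\omega$; it is determined by its values on the $s^i$. Curvature. $R_\nabla=(\mathrm{d}\otimes\mathrm{id}-\mathrm{id}\wedge\nabla)\nabla:\Omega^1\to\Omega^2\otimes_A\Omega^1$. Let $i:\Omega^2\to\Omega^1\otimes_A\Omega^1$ be the bimodule map $i(s^j\wedge s^k)=\tfrac12(s^j\otimes s^k-s^k\otimes s^j)$. Then $$\mathrm{Ricci}=((\ ,\ )\otimes\mathrm{id})(\mathrm{id}\otimes i\otimes\mathrm{id})(\mathrm{id}\otimes R_\nabla)(g)\in\Omega^1\otimes_A\Omega^1,\qquad S=(\ ,\ )(\mathrm{Ricci})\in A.$$ (In these conventions the classical limit of $S$ is $-\tfrac12$ of the usual scalar curvature.) *)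

theory Defs
  imports "HOL-Analysis.Analysis" "HOL-Library.Poly_Mapping"
begin

text \<open>The type \<open>3\<close> has the elements \<open>1\<close>, \<open>2\<close> and \<open>3 = 0\<close>.\<close>

definition eps :: "3 \<Rightarrow> 3 \<Rightarrow> 3 \<Rightarrow> 'b::ring_1" where
  "eps i j k =
     (if (i, j, k) \<in> {(1, 2, 3), (2, 3, 1), (3, 1, 2)} then 1
      else if (i, j, k) \<in> {(3, 2, 1), (2, 1, 3), (1, 3, 2)} then - 1
      else 0)"

class complex_star_algebra = ring_1 +
  fixes scaleC :: "complex \<Rightarrow> 'a \<Rightarrow> 'a"  (infixr "*\<^sub>C" 75)
    and star :: "'a \<Rightarrow> 'a"
  assumes scaleC_add_right: "c *\<^sub>C (a + b) = c *\<^sub>C a + c *\<^sub>C b"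
    and scaleC_add_left: "(c + c') *\<^sub>C a = c *\<^sub>C a + c' *\<^sub>C a"
    and scaleC_scaleC: "c *\<^sub>C (c' *\<^sub>C a) = (c * c') *\<^sub>C a"
    and scaleC_one: "1 *\<^sub>C a = a"
    and mult_scaleC_left: "(c *\<^sub>C a) * b = c *\<^sub>C (a * b)"
    and mult_scaleC_right: "a * (c *\<^sub>C b) = c *\<^sub>C (a * b)"
    and star_star: "star (star a) = a"
    and star_add: "star (a + b) = star a + star b"
    and star_scaleC: "star (c *\<^sub>C a) = cnj c *\<^sub>C star a"
    and star_mult: "star (a * b) = star b * star a"

definition of_cplx :: "complex \<Rightarrow> 'a::complex_star_algebra" where
  "of_cplx c = c *\<^sub>C 1"

text \<open>Words in three letters form the free monoid, written additively, so that
  \<open>word3 \<Rightarrow>\<^sub>0 complex\<close> with its convolution product is the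
  free unital complex algebra on three generators.\<close>

datatype word3 = Word (letters: "3 list")

instantiation word3 :: monoid_add
begin
definition zero_word3 :: word3 where "zero_word3 = Word []"
definition plus_word3 :: "word3 \<Rightarrow> word3 \<Rightarrow> word3" where
  "plus_word3 u v = Word (letters u @ letters v)"
instance by standard (simp_all add: zero_word3_def plus_word3_def)
end

type_synonym free_alg = "word3 \<Rightarrow>\<^sub>0 complex"

definition gen :: "3 \<Rightarrow> free_alg" where
  "gen i = Poly_Mapping.single (Word [i]) 1"

definition const :: "complex \<Rightarrow> free_alg" where
  "const c = Poly_Mapping.single 0 c"

definition eval :: "(3 \<Rightarrow> 'a::complex_star_algebra) \<Rightarrow> free_alg \<Rightarrow> 'a" where
  "eval x p = (\<Sum>w\<in>Poly_Mapping.keys p.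
     Poly_Mapping.lookup p w *\<^sub>C prod_list (map x (letters w)))"

inductive_set two_sided_ideal :: "'r::ring_1 set \<Rightarrow> 'r set" for G :: "'r set" where
  zero: "0 \<in> two_sided_ideal G"
| step: "p \<in> two_sided_ideal G \<Longrightarrow> r \<in> G \<Longrightarrow> p + u * r * v \<in> two_sided_ideal G"

definition fuzzy_relations :: "real \<Rightarrow> free_alg set" where
  "fuzzy_relations lam =
     {gen i * gen j - gen j * gen i
        - (\<Sum>k\<in>UNIV. const (2 * \<i> * complex_of_real lam * eps i j k) * gen k) | i j. True}
     \<union> {(\<Sum>i\<in>UNIV. gen i * gen i) - const (1 - (complex_of_real lam)\<^sup>2)}"

text \<open>\<open>fuzzy_sphere lam x\<close>: the \<open>*\<close>-algebra \<open>'a\<close> together with its elements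
  \<open>x 1, x 2, x 3\<close> is the one presented by self-adjoint generators and the relations of the
  fuzzy sphere, that is, evaluation at \<open>x\<close> identifies \<open>'a\<close> with the quotient of the free
  algebra by the ideal of the relations. As this ideal is stable under the conjugate linear
  anti-automorphism fixing the generators, this is also the presentation as a \<open>*\<close>-algebra.\<close>

definition fuzzy_sphere :: "real \<Rightarrow> (3 \<Rightarrow> 'a::complex_star_algebra) \<Rightarrow> bool" where
  "fuzzy_sphere lam x \<longleftrightarrow>
     (\<forall>i. star (x i) = x i) \<and>
     surj (eval x) \<and>
     (\<forall>p. eval x p = 0 \<longleftrightarrow> p \<in> two_sided_ideal (fuzzy_relations lam))"

text \<open>An \<open>A\<close>-bimodule that is free as a left module on a finite central basis
  \<open>e\<^sub>i\<close> (\<open>bvec i\<close> below) is \<open>'a ^ 'm\<close>: the vector \<open>\<omega>\<close> stands for \<open>\<Sum>\<^sub>i \<omega>\<^sub>i e\<^sub>i\<close>, the left action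
  is \<^term>\<open>(*s)\<close>, and the right action multiplies the components on the right. Since
  \<open>\<omega>\<^sub>i e\<^sub>i \<otimes> \<eta>\<^sub>j e\<^sub>j = \<omega>\<^sub>i \<eta>\<^sub>j e\<^sub>i \<otimes> e\<^sub>j\<close>, the tensor product over \<open>A\<close> of two such bimodules
  is again of this kind, with basis indexed by the pairs.\<close>

definition bvec :: "'m \<Rightarrow> 'a::complex_star_algebra ^ 'm::finite" where
  "bvec i = axis i 1"

definition rsmult :: "'a::complex_star_algebra ^ 'm \<Rightarrow> 'a \<Rightarrow> 'a ^ 'm"  (infixl "s*" 70) where
  "\<omega> s* a = (\<chi> i. \<omega> $ i * a)"

definition tens ::
  "'a::complex_star_algebra ^ 'm \<Rightarrow> 'a ^ 'n \<Rightarrow> 'a ^ ('m \<times> 'n)"  (infixr "\<otimes>\<^sub>A" 75) where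
  "\<omega> \<otimes>\<^sub>A \<eta> = (\<chi> p. \<omega> $ fst p * \<eta> $ snd p)"

text \<open>\<open>tens_map f h\<close> is \<open>f \<otimes> h\<close> for a right module map \<open>f\<close> and a left module map \<open>h\<close>, and
  \<open>tens_map_A f\<close> is \<open>f \<otimes> id\<close> for an \<open>A\<close>-valued \<open>f\<close>, with \<open>A \<otimes>\<^sub>A N\<close> identified with \<open>N\<close>;
  see \<open>tens_map_tens\<close> and \<open>tens_map_A_tens\<close> below.\<close>

definition tens_map ::
  "('a::complex_star_algebra ^ 'm::finite \<Rightarrow> 'a ^ 'p) \<Rightarrow> ('a ^ 'n::finite \<Rightarrow> 'a ^ 'q)
    \<Rightarrow> 'a ^ ('m \<times> 'n) \<Rightarrow> 'a ^ ('p \<times> 'q)" where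
  "tens_map f h T = (\<Sum>i\<in>UNIV. \<Sum>j\<in>UNIV. f (T $ (i, j) *s bvec i) \<otimes>\<^sub>A h (bvec j))"

definition tens_map_A ::
  "('a::complex_star_algebra ^ 'm::finite \<Rightarrow> 'a) \<Rightarrow> 'a ^ ('m \<times> 'n::finite) \<Rightarrow> 'a ^ 'n" where
  "tens_map_A f T = (\<Sum>i\<in>UNIV. \<Sum>j\<in>UNIV. f (T $ (i, j) *s bvec i) *s bvec j)"

definition reassoc ::
  "'a ^ ('m::finite \<times> ('n::finite \<times> 'p::finite) \<times> 'q::finite) \<Rightarrow> 'a ^ (('m \<times> 'n) \<times> ('p \<times> 'q))" where
  "reassoc T = vec_lambda (\<lambda>((i, j), (k, l)). T $ (i, (j, k), l))"

text \<open>\<open>\<Omega>\<^sup>1\<close> has the basis \<open>s\<^sup>i\<close>. \<open>\<Omega>\<^sup>2\<close> has the central basis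
  \<open>s\<^sup>2 \<and> s\<^sup>3, s\<^sup>3 \<and> s\<^sup>1, s\<^sup>1 \<and> s\<^sup>2\<close> (in this order), so that
  \<open>s\<^sup>i \<and> s\<^sup>j = \<Sum>\<^sub>k \<epsilon>\<^sub>i\<^sub>j\<^sub>k e\<^sub>k\<close>. Higher forms play no role for the curvature.\<close>

type_synonym 'a form1 = "'a ^ 3"
type_synonym 'a form2 = "'a ^ 3"

abbreviation s :: "3 \<Rightarrow> 'a::complex_star_algebra form1" where
  "s \<equiv> bvec"

definition wedge ::
  "'a::complex_star_algebra form1 \<Rightarrow> 'a form1 \<Rightarrow> 'a form2"  (infixr "\<and>\<^sub>A" 75) where
  "\<omega> \<and>\<^sub>A \<eta> = (\<Sum>i\<in>UNIV. \<Sum>j\<in>UNIV. \<Sum>k\<in>UNIV. (\<omega> $ i * \<eta> $ j * eps i j k) *s bvec k)"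

definition derivation ::
  "('a::complex_star_algebra \<Rightarrow> 'a form1) \<Rightarrow> bool" where
  "derivation D \<longleftrightarrow>
     (\<forall>a b. D (a + b) = D a + D b) \<and>
     (\<forall>c a. D (c *\<^sub>C a) = of_cplx c *s D a) \<and>
     (\<forall>a b. D (a * b) = D a s* b + a *s D b)"

text \<open>The derivation is unique and, over the fuzzy sphere, exists: \<open>d0_derivation\<close> below.\<close>

definition d0 ::
  "(3 \<Rightarrow> 'a::complex_star_algebra) \<Rightarrow> 'a \<Rightarrow> 'a form1" where
  "d0 x = (THE D. derivation D \<and>
     (\<forall>i. D (x i) = (\<Sum>j\<in>UNIV. \<Sum>k\<in>UNIV. (eps i j k * x j) *s s k)))"

definition d_s :: "3 \<Rightarrow> 'a::complex_star_algebra form2" where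
  "d_s i = of_cplx (- 1/2) *s (\<Sum>j\<in>UNIV. \<Sum>k\<in>UNIV. eps i j k *s (s j \<and>\<^sub>A s k))"

text \<open>The graded Leibniz rule on either side holds by \<open>d1_smult\<close> and \<open>d1_rsmult\<close> below.\<close>

definition d1 ::
  "(3 \<Rightarrow> 'a::complex_star_algebra) \<Rightarrow> 'a form1 \<Rightarrow> 'a form2" where
  "d1 x \<omega> = (\<Sum>i\<in>UNIV. d0 x (\<omega> $ i) \<and>\<^sub>A s i + \<omega> $ i *s d_s i)"

definition metric :: "real ^ 3 ^ 3 \<Rightarrow> 'a::complex_star_algebra ^ (3 \<times> 3)" where
  "metric g = (\<Sum>i\<in>UNIV. \<Sum>j\<in>UNIV. of_cplx (complex_of_real (g $ i $ j)) *s (s i \<otimes>\<^sub>A s j))"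

definition pairing :: "real ^ 3 ^ 3 \<Rightarrow> 'a::complex_star_algebra ^ (3 \<times> 3) \<Rightarrow> 'a" where
  "pairing g T =
     (\<Sum>i\<in>UNIV. \<Sum>j\<in>UNIV. T $ (i, j) * of_cplx (complex_of_real (matrix_inv g $ i $ j)))"

definition left_connection ::
  "(3 \<Rightarrow> 'a::complex_star_algebra) \<Rightarrow> ('a form1 \<Rightarrow> 'a ^ (3 \<times> 3)) \<Rightarrow> bool" where
  "left_connection x nabla \<longleftrightarrow>
     (\<forall>\<omega> \<eta>. nabla (\<omega> + \<eta>) = nabla \<omega> + nabla \<eta>) \<and>
     (\<forall>c \<omega>. nabla (of_cplx c *s \<omega>) = of_cplx c *s nabla \<omega>) \<and>
     (\<forall>a \<omega>. nabla (a *s \<omega>) = d0 x a \<otimes>\<^sub>A \<omega> + a *s nabla \<omega>)"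

text \<open>\<open>wedge_tens \<omega> T\<close> is \<open>\<omega> \<and> T\<close> for \<open>T \<in> \<Omega>\<^sup>1 \<otimes>\<^sub>A \<Omega>\<^sup>1\<close>, where
  \<open>\<omega> \<and> (\<eta> \<otimes> \<zeta>) = (\<omega> \<and> \<eta>) \<otimes> \<zeta>\<close>.\<close>

definition wedge_tens ::
  "'a::complex_star_algebra form1 \<Rightarrow> 'a ^ (3 \<times> 3) \<Rightarrow> 'a ^ (3 \<times> 3)" where
  "wedge_tens \<omega> T = tens_map (\<lambda>\<eta>. \<omega> \<and>\<^sub>A \<eta>) id T"

text \<open>The map \<open>d \<otimes> id - id \<and> \<nabla>\<close> from \<open>\<Omega>\<^sup>1 \<otimes>\<^sub>A \<Omega>\<^sup>1\<close> to \<open>\<Omega>\<^sup>2 \<otimes>\<^sub>A \<Omega>\<^sup>1\<close>, whose two terms are not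
  separately well defined over \<open>A\<close>, computed on \<open>T = \<Sum>\<^sub>i\<^sub>j T\<^sub>i\<^sub>j s\<^sup>i \<otimes> s\<^sup>j\<close>. For a connection it
  sends \<open>\<omega> \<otimes> \<eta>\<close> to \<open>d\<omega> \<otimes> \<eta> - \<omega> \<and> \<nabla>\<eta>\<close>, see \<open>d_nabla_tens\<close> below.\<close>

definition d_nabla ::
  "(3 \<Rightarrow> 'a::complex_star_algebra) \<Rightarrow> ('a form1 \<Rightarrow> 'a ^ (3 \<times> 3)) \<Rightarrow> 'a ^ (3 \<times> 3) \<Rightarrow> 'a ^ (3 \<times> 3)"
  where
  "d_nabla x nabla T = (\<Sum>i\<in>UNIV. \<Sum>j\<in>UNIV.
     d1 x (T $ (i, j) *s s i) \<otimes>\<^sub>A s j - wedge_tens (T $ (i, j) *s s i) (nabla (s j)))"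

definition curvature ::
  "(3 \<Rightarrow> 'a::complex_star_algebra) \<Rightarrow> ('a form1 \<Rightarrow> 'a ^ (3 \<times> 3)) \<Rightarrow> 'a form1 \<Rightarrow> 'a ^ (3 \<times> 3)" where
  "curvature x nabla \<omega> = d_nabla x nabla (nabla \<omega>)"

text \<open>The lift \<open>i\<close>; it is given here on the basis of \<open>\<Omega>\<^sup>2\<close>, and on all \<open>s\<^sup>j \<and> s\<^sup>k\<close> in
  \<open>lift_wedge\<close> below.\<close>

definition lift :: "'a::complex_star_algebra form2 \<Rightarrow> 'a ^ (3 \<times> 3)" where
  "lift B = (\<Sum>(k, i, j)\<in>{(1, 2, 3), (2, 3, 1), (3, 1, 2)}.
     B $ k *s (of_cplx (1/2) *s (s i \<otimes>\<^sub>A s j - s j \<otimes>\<^sub>A s i)))"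

definition ricci ::
  "(3 \<Rightarrow> 'a::complex_star_algebra) \<Rightarrow> real ^ 3 ^ 3 \<Rightarrow> ('a form1 \<Rightarrow> 'a ^ (3 \<times> 3)) \<Rightarrow> 'a ^ (3 \<times> 3)" where
  "ricci x g nabla =
     tens_map_A (pairing g)
       (reassoc (tens_map id (tens_map lift id) (tens_map id (curvature x nabla) (metric g))))"

definition scalar_curvature ::
  "(3 \<Rightarrow> 'a::complex_star_algebra) \<Rightarrow> real ^ 3 ^ 3 \<Rightarrow> ('a form1 \<Rightarrow> 'a ^ (3 \<times> 3)) \<Rightarrow> 'a" where
  "scalar_curvature x g nabla = pairing g (ricci x g nabla)"

lemma three_cases: "(i::3) = 1 \<or> i = 2 \<or> i = 3"
  using exhaust_3 by blast

lemma eps_cyclic: "eps k i j = eps i j k"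
  by (auto simp: eps_def)

lemma eps_swap: "eps j i k = - eps i j k"
  using three_cases[of i] three_cases[of j] three_cases[of k]
  by (elim disjE) (simp_all add: eps_def)

lemma eps_of_cplx: "(eps i j k :: 'a::complex_star_algebra) = of_cplx (eps i j k)"
proof -
  have m: "(- 1) *\<^sub>C (1::'a) = - 1"
    using scaleC_add_left[of "- 1" 1 "1::'a"] scaleC_add_left[of 0 0 "1::'a"]
    by (simp add: scaleC_one eq_neg_iff_add_eq_0)
  have z: "0 *\<^sub>C (1::'a) = 0"
    using scaleC_add_left[of 0 0 "1::'a"] by simp
  show ?thesis by (simp add: eps_def of_cplx_def scaleC_one m z)
qed

lemma scaleC_0_left: "0 *\<^sub>C (a::'a::complex_star_algebra) = 0"
  using scaleC_add_left[of 0 0 a] by simp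

lemma scaleC_0_right: "c *\<^sub>C (0::'a::complex_star_algebra) = 0"
  using scaleC_add_right[of c 0 "0::'a"] by simp

lemma scaleC_minus_left: "(- c) *\<^sub>C (a::'a::complex_star_algebra) = - (c *\<^sub>C a)"
  using scaleC_add_left[of "- c" c a] by (simp add: scaleC_0_left eq_neg_iff_add_eq_0)

lemma scaleC_sum_left:
  "(\<Sum>i\<in>I. f i) *\<^sub>C (a::'a::complex_star_algebra) = (\<Sum>i\<in>I. f i *\<^sub>C a)"
  by (induction I rule: infinite_finite_induct) (simp_all add: scaleC_0_left scaleC_add_left)

lemma of_cplx_mult_left: "of_cplx c * (a::'a::complex_star_algebra) = c *\<^sub>C a"
  by (simp add: of_cplx_def mult_scaleC_left)

lemma of_cplx_mult_right: "(a::'a::complex_star_algebra) * of_cplx c = c *\<^sub>C a"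
  by (simp add: of_cplx_def mult_scaleC_right)

lemma eps_central: "eps i j k * (a::'a::complex_star_algebra) = a * eps i j k"
  by (simp add: eps_def)

lemma eval_superset:
  assumes "finite W" "Poly_Mapping.keys p \<subseteq> W"
  shows "eval x p = (\<Sum>w\<in>W. Poly_Mapping.lookup p w *\<^sub>C prod_list (map x (letters w)))"
  unfolding eval_def
  by (rule sum.mono_neutral_left) (use assms in \<open>auto simp: in_keys_iff scaleC_0_left\<close>)

lemma eval_add: "eval x (p + q) = eval x p + eval x q"
proof -
  let ?W = "Poly_Mapping.keys p \<union> Poly_Mapping.keys q"
  have "Poly_Mapping.keys (p + q) \<subseteq> ?W" by (rule Poly_Mapping.keys_add)
  then show ?thesis
    by (simp add: eval_superset[of ?W] lookup_add scaleC_add_left sum.distrib)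
qed

lemma eval_zero: "eval x 0 = 0"
  by (simp add: eval_def)

lemma eval_minus: "eval x (- p) = - eval x p"
  using eval_add[of x "- p" p] by (simp add: eval_zero eq_neg_iff_add_eq_0)

lemma eval_diff: "eval x (p - q) = eval x p - eval x q"
  using eval_add[of x p "- q"] by (simp add: eval_minus)

lemma eval_sum: "eval x (\<Sum>i\<in>I. p i) = (\<Sum>i\<in>I. eval x (p i))"
  by (induction I rule: infinite_finite_induct) (simp_all add: eval_zero eval_add)

lemma eval_single:
  "eval x (Poly_Mapping.single w c) = c *\<^sub>C prod_list (map x (letters w))"
  by (simp add: eval_def scaleC_0_left)

lemma in_two_sided_ideal: "r \<in> G \<Longrightarrow> r \<in> two_sided_ideal G"
  using two_sided_ideal.step[OF two_sided_ideal.zero, of r G 1 1] by simp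

lemma fuzzy_sphere_commutator:
  assumes "fuzzy_sphere lam x"
  shows "x i * x j - x j * x i
    = (\<Sum>k\<in>UNIV. (2 * \<i> * complex_of_real lam * eps i j k) *\<^sub>C x k)"
proof -
  let ?r = "gen i * gen j - gen j * gen i
    - (\<Sum>k\<in>UNIV. const (2 * \<i> * complex_of_real lam * eps i j k) * gen k)"
  have "?r \<in> fuzzy_relations lam" unfolding fuzzy_relations_def by blast
  then have "eval x ?r = 0"
    using assms in_two_sided_ideal unfolding fuzzy_sphere_def by blast
  then show ?thesis
    by (simp add: eval_diff eval_sum gen_def const_def mult_single eval_single
        plus_word3_def zero_word3_def scaleC_one)
qed

lemma fuzzy_sphere_radius:
  assumes "fuzzy_sphere lam x"
  shows "(\<Sum>i\<in>UNIV. x i * x i) = of_cplx (1 - (complex_of_real lam)\<^sup>2)"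
proof -
  let ?r = "(\<Sum>i\<in>UNIV. gen i * gen i) - const (1 - (complex_of_real lam)\<^sup>2)"
  have "?r \<in> fuzzy_relations lam" unfolding fuzzy_relations_def by blast
  then have "eval x ?r = 0"
    using assms in_two_sided_ideal unfolding fuzzy_sphere_def by blast
  then show ?thesis
    by (simp add: eval_diff eval_sum gen_def const_def mult_single eval_single
        plus_word3_def zero_word3_def scaleC_one of_cplx_def)
qed

lemma derivation_0_1:
  assumes "derivation D"
  shows "D 0 = 0" "D 1 = 0"
proof -
  have "D (0 + 0) = D 0 + D 0" using assms unfolding derivation_def by blast
  then show "D 0 = 0" by simp
  have "D (1 * 1) = D 1 s* 1 + 1 *s D 1" using assms unfolding derivation_def by blast
  then show "D 1 = 0" by (simp add: rsmult_def vec_eq_iff)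
qed

lemma derivation_unique:
  assumes "surj (eval x)" "derivation D" "derivation D'" "\<And>i. D (x i) = D' (x i)"
  shows "D = D'"
proof
  fix a
  have word: "D (prod_list (map x u)) = D' (prod_list (map x u))" for u
  proof (induction u)
    case Nil
    then show ?case by (simp add: derivation_0_1[OF assms(2)] derivation_0_1[OF assms(3)])
  next
    case (Cons i u)
    then show ?case using assms(2-4) unfolding derivation_def by simp
  qed
  have sums: "D (\<Sum>w\<in>W. c w *\<^sub>C prod_list (map x (u w)))
      = D' (\<Sum>w\<in>W. c w *\<^sub>C prod_list (map x (u w)))"
    for W :: "word3 set" and c u
  proof (induction W rule: infinite_finite_induct)
    case (insert w W)
    then show ?case using assms(2,3) word unfolding derivation_def by simp
  qed (simp_all add: derivation_0_1[OF assms(2)] derivation_0_1[OF assms(3)])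
  obtain p where "a = eval x p" using assms(1) by (metis surjD)
  then show "D a = D' a" by (simp add: eval_def sums)
qed

lemma derivation_exists:
  fixes x :: "3 \<Rightarrow> 'a::complex_star_algebra"
  assumes "fuzzy_sphere lam x" "lam \<noteq> 0"
  shows "\<exists>D. derivation D \<and>
     (\<forall>i. D (x i) = (\<Sum>j\<in>UNIV. \<Sum>k\<in>UNIV. (eps i j k * x j) *s s k))"
proof (intro exI conjI allI)
  let ?c = "1 / (2 * \<i> * complex_of_real lam)"
  let ?D = "\<lambda>a. (\<chi> k. ?c *\<^sub>C (x k * a - a * x k)) :: 'a form1"
  have neg: "c *\<^sub>C (- a) = - (c *\<^sub>C a)" for c and a :: 'a
    using scaleC_add_right[of c "- a" a] by (simp add: scaleC_0_right eq_neg_iff_add_eq_0)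
  have sub: "c *\<^sub>C (a - b) = c *\<^sub>C a - c *\<^sub>C b" for c and a b :: 'a
    using scaleC_add_right[of c a "- b"] by (simp add: neg)
  show "derivation ?D"
    unfolding derivation_def
    by (auto simp: vec_eq_iff rsmult_def of_cplx_mult_left mult_scaleC_left mult_scaleC_right
        scaleC_scaleC sub mult.assoc scaleC_add_right algebra_simps mult.commute[of _ ?c])
  fix i
  have "?D (x i) $ k = (\<Sum>j\<in>UNIV. \<Sum>k\<in>UNIV. (eps i j k * x j) *s s k) $ k" for k
  proof -
    have "?c *\<^sub>C (\<Sum>j\<in>UNIV. (2 * \<i> * complex_of_real lam * eps k i j) *\<^sub>C x j)
        = (\<Sum>j\<in>UNIV. eps k i j *\<^sub>C x j)"
      using assms(2)
      by (simp add: sum_3 scaleC_add_right scaleC_scaleC)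
    also have "\<dots> = (\<Sum>j\<in>UNIV. eps i j k * x j)"
      by (subst eps_of_cplx) (simp add: of_cplx_mult_left eps_cyclic)
    also have "\<dots> = (\<Sum>j\<in>UNIV. \<Sum>k\<in>UNIV. (eps i j k * x j) *s s k) $ k"
      by (simp add: sum_component bvec_def axis_def if_distrib sum.delta cong: if_cong)
    finally show ?thesis
      by (simp add: fuzzy_sphere_commutator[OF assms(1)])
  qed
  then show "?D (x i) = (\<Sum>j\<in>UNIV. \<Sum>k\<in>UNIV. (eps i j k * x j) *s s k)"
    by (simp add: vec_eq_iff)
qed

lemma d0_derivation:
  assumes "fuzzy_sphere lam x" "lam \<noteq> 0"
  shows "derivation (d0 x)"
    and "d0 x (x i) = (\<Sum>j\<in>UNIV. \<Sum>k\<in>UNIV. (eps i j k * x j) *s s k)"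
proof -
  have "\<exists>!D. derivation D \<and>
     (\<forall>i. D (x i) = (\<Sum>j\<in>UNIV. \<Sum>k\<in>UNIV. (eps i j k * x j) *s s k))"
    (is "\<exists>!D. ?P D")
  proof (rule ex_ex1I)
    show "\<exists>D. ?P D" by (rule derivation_exists[OF assms])
    show "D = D'" if "?P D" "?P D'" for D D'
      using that assms(1) derivation_unique[of x D D'] unfolding fuzzy_sphere_def by simp
  qed
  from theI'[OF this]
  have "derivation (d0 x) \<and>
     (\<forall>i. d0 x (x i) = (\<Sum>j\<in>UNIV. \<Sum>k\<in>UNIV. (eps i j k * x j) *s s k))"
    unfolding d0_def .
  then show "derivation (d0 x)"
    and "d0 x (x i) = (\<Sum>j\<in>UNIV. \<Sum>k\<in>UNIV. (eps i j k * x j) *s s k)"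
    by blast+
qed

lemma bvec_central: "a *s bvec i = bvec i s* a"
  by (simp add: vec_eq_iff rsmult_def bvec_def axis_def)

lemma bvec_expansion: "\<omega> = (\<Sum>i\<in>UNIV. \<omega> $ i *s bvec i)"
  by (simp add: vec_eq_iff sum_component bvec_def axis_def if_distrib sum.delta cong: if_cong)

lemma tens_balanced: "(\<omega> s* a) \<otimes>\<^sub>A \<eta> = \<omega> \<otimes>\<^sub>A (a *s \<eta>)"
  by (simp add: vec_eq_iff tens_def rsmult_def mult.assoc)

lemma tens_smult: "(a *s \<omega>) \<otimes>\<^sub>A \<eta> = a *s (\<omega> \<otimes>\<^sub>A \<eta>)"
  by (simp add: vec_eq_iff tens_def mult.assoc)

lemma tens_rsmult: "\<omega> \<otimes>\<^sub>A (\<eta> s* a) = (\<omega> \<otimes>\<^sub>A \<eta>) s* a"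
  by (simp add: vec_eq_iff tens_def rsmult_def mult.assoc)

lemma tens_add_left: "(\<omega> + \<omega>') \<otimes>\<^sub>A \<eta> = \<omega> \<otimes>\<^sub>A \<eta> + \<omega>' \<otimes>\<^sub>A \<eta>"
  by (simp add: vec_eq_iff tens_def algebra_simps)

lemma tens_add_right: "\<omega> \<otimes>\<^sub>A (\<eta> + \<eta>') = \<omega> \<otimes>\<^sub>A \<eta> + \<omega> \<otimes>\<^sub>A \<eta>'"
  by (simp add: vec_eq_iff tens_def algebra_simps)

lemma tens_0_left: "0 \<otimes>\<^sub>A \<eta> = 0"
  by (simp add: vec_eq_iff tens_def)

lemma tens_0_right: "\<omega> \<otimes>\<^sub>A 0 = 0"
  by (simp add: vec_eq_iff tens_def)

lemma tens_sum_left: "(\<Sum>i\<in>I. \<omega> i) \<otimes>\<^sub>A \<eta> = (\<Sum>i\<in>I. \<omega> i \<otimes>\<^sub>A \<eta>)"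
  by (induction I rule: infinite_finite_induct) (simp_all add: tens_add_left tens_0_left)

lemma tens_sum_right: "\<omega> \<otimes>\<^sub>A (\<Sum>i\<in>I. \<eta> i) = (\<Sum>i\<in>I. \<omega> \<otimes>\<^sub>A \<eta> i)"
  by (induction I rule: infinite_finite_induct) (simp_all add: tens_add_right tens_0_right)

lemma additive_0:
  fixes f :: "'a::comm_monoid_add \<Rightarrow> 'b::ab_group_add"
  assumes "\<And>a b. f (a + b) = f a + f b"
  shows "f 0 = 0"
  using assms[of 0 0] by simp

lemma additive_sum:
  fixes f :: "'a::comm_monoid_add \<Rightarrow> 'b::ab_group_add"
  assumes "\<And>a b. f (a + b) = f a + f b"
  shows "f (\<Sum>i\<in>I. u i) = (\<Sum>i\<in>I. f (u i))"
  by (induction I rule: infinite_finite_induct) (simp_all add: additive_0[of f, OF assms] assms)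

lemma balanced_expansion:
  assumes left: "\<And>\<omega> \<omega>' \<eta>. F (\<omega> + \<omega>') \<eta> = F \<omega> \<eta> + (F \<omega>' \<eta> :: 'c::ab_group_add)"
    and right: "\<And>\<omega> \<eta> \<eta>'. F \<omega> (\<eta> + \<eta>') = F \<omega> \<eta> + F \<omega> \<eta>'"
    and balanced: "\<And>\<omega> a \<eta>. F (\<omega> s* a) \<eta> = F \<omega> (a *s \<eta>)"
  shows "(\<Sum>i\<in>UNIV. \<Sum>j\<in>UNIV. F ((\<omega> \<otimes>\<^sub>A \<eta>) $ (i, j) *s bvec i) (bvec j)) = F \<omega> \<eta>"
proof -
  have r: "(\<omega> $ i * \<eta> $ j) *s bvec i = (\<omega> $ i *s bvec i) s* (\<eta> $ j)" for i j
    by (simp add: vec_eq_iff rsmult_def bvec_def axis_def)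
  have "F \<omega> \<eta> = F (\<Sum>i\<in>UNIV. \<omega> $ i *s bvec i) (\<Sum>j\<in>UNIV. \<eta> $ j *s bvec j)"
    by (simp flip: bvec_expansion)
  also have "\<dots> = (\<Sum>i\<in>UNIV. \<Sum>j\<in>UNIV. F (\<omega> $ i *s bvec i) (\<eta> $ j *s bvec j))"
    by (subst additive_sum[of "\<lambda>\<omega>. F \<omega> _", OF left], subst additive_sum[of "F _", OF right]) simp
  finally show ?thesis by (simp add: tens_def r balanced)
qed

lemma tens_map_tens:
  assumes f: "\<And>\<omega> \<omega>'. f (\<omega> + \<omega>') = f \<omega> + f \<omega>'" "\<And>\<omega> a. f (\<omega> s* a) = f \<omega> s* a"
    and h: "\<And>\<eta> \<eta>'. h (\<eta> + \<eta>') = h \<eta> + h \<eta>'" "\<And>a \<eta>. h (a *s \<eta>) = a *s h \<eta>"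
  shows "tens_map f h (\<omega> \<otimes>\<^sub>A \<eta>) = f \<omega> \<otimes>\<^sub>A h \<eta>"
  unfolding tens_map_def
  by (rule balanced_expansion[of "\<lambda>\<omega> \<eta>. f \<omega> \<otimes>\<^sub>A h \<eta>"])
    (simp_all add: f h tens_add_left tens_add_right tens_balanced)

lemma tens_map_A_tens:
  assumes f: "\<And>\<omega> \<omega>'. f (\<omega> + \<omega>') = f \<omega> + f \<omega>'" "\<And>\<omega> a. f (\<omega> s* a) = f \<omega> * a"
  shows "tens_map_A f (\<omega> \<otimes>\<^sub>A \<eta>) = f \<omega> *s \<eta>"
proof -
  have r: "((\<omega> $ i * \<eta> $ j) *s bvec i) = (\<omega> $ i *s bvec i) s* (\<eta> $ j)" for i j
    by (simp add: vec_eq_iff rsmult_def bvec_def axis_def)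
  have "tens_map_A f (\<omega> \<otimes>\<^sub>A \<eta>)
      = (\<Sum>i\<in>UNIV. \<Sum>j\<in>UNIV. (f (\<omega> $ i *s bvec i) * \<eta> $ j) *s bvec j)"
    by (simp add: tens_map_A_def tens_def r f(2))
  also have "\<dots> = (\<Sum>i\<in>UNIV. f (\<omega> $ i *s bvec i) *s \<eta>)"
    by (simp add: vec_eq_iff sum_component bvec_def axis_def if_distrib sum.delta cong: if_cong)
  also have "\<dots> = (\<Sum>i\<in>UNIV. f (\<omega> $ i *s bvec i)) *s \<eta>"
    by (simp add: vec_eq_iff sum_component sum_distrib_right)
  also have "(\<Sum>i\<in>UNIV. f (\<omega> $ i *s bvec i)) = f \<omega>"
    by (simp add: additive_sum[of f, OF f(1), symmetric] flip: bvec_expansion)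
  finally show ?thesis .
qed

lemma reassoc_tens:
  "reassoc (\<omega> \<otimes>\<^sub>A (\<eta> \<otimes>\<^sub>A \<zeta>) \<otimes>\<^sub>A \<xi>) = (\<omega> \<otimes>\<^sub>A \<eta>) \<otimes>\<^sub>A (\<zeta> \<otimes>\<^sub>A \<xi>)"
  by (auto simp: vec_eq_iff reassoc_def tens_def mult.assoc)

lemma wedge_add_left: "(\<omega> + \<omega>') \<and>\<^sub>A \<eta> = \<omega> \<and>\<^sub>A \<eta> + \<omega>' \<and>\<^sub>A \<eta>"
  by (simp add: wedge_def algebra_simps sum.distrib)

lemma wedge_add_right: "\<omega> \<and>\<^sub>A (\<eta> + \<eta>') = \<omega> \<and>\<^sub>A \<eta> + \<omega> \<and>\<^sub>A \<eta>'"
  by (simp add: wedge_def algebra_simps sum.distrib)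

lemma wedge_smult: "(a *s \<omega>) \<and>\<^sub>A \<eta> = a *s (\<omega> \<and>\<^sub>A \<eta>)"
  by (simp add: wedge_def vec_eq_iff sum_component sum_distrib_left mult.assoc)

lemma wedge_component:
  "(\<omega> \<and>\<^sub>A \<eta>) $ k = (\<Sum>i\<in>UNIV. \<Sum>j\<in>UNIV. \<omega> $ i * \<eta> $ j * eps i j k)"
  by (simp add: wedge_def sum_component bvec_def axis_def if_distrib sum.delta cong: if_cong)

lemma wedge_rsmult: "\<omega> \<and>\<^sub>A (\<eta> s* a) = (\<omega> \<and>\<^sub>A \<eta>) s* a"
  by (simp add: vec_eq_iff wedge_component rsmult_def sum_distrib_right mult.assoc eps_central)

lemma wedge_balanced: "(\<omega> s* a) \<and>\<^sub>A \<eta> = \<omega> \<and>\<^sub>A (a *s \<eta>)"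
  by (simp add: wedge_def rsmult_def mult.assoc)

lemma bvec_component: "bvec i $ j = (if j = i then 1 else 0)"
  by (simp add: bvec_def axis_def)

lemma wedge_s_left: "(s i \<and>\<^sub>A \<eta>) $ k = (\<Sum>j\<in>UNIV. \<eta> $ j * eps i j k)"
  unfolding wedge_component bvec_component
  by (subst (2) sum.remove[of _ i]) auto

lemma wedge_s_right: "(\<eta> \<and>\<^sub>A s i) $ k = (\<Sum>j\<in>UNIV. \<eta> $ j * eps j i k)"
  unfolding wedge_component bvec_component
  by (intro sum.cong refl, subst sum.remove[of _ i]) auto

lemma wedge_s_component: "(s i \<and>\<^sub>A s j) $ k = eps i j k"
  unfolding wedge_s_left bvec_component
  by (subst sum.remove[of _ j]) auto

lemma wedge_s: "s i \<and>\<^sub>A s j = (\<Sum>k\<in>UNIV. eps i j k *s bvec k)"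
  using bvec_expansion[of "s i \<and>\<^sub>A s j"] unfolding wedge_s_component .

lemma wedge_anticommute_s: "\<eta> \<and>\<^sub>A s i = - (s i \<and>\<^sub>A \<eta>)"
proof -
  have "(\<eta> \<and>\<^sub>A s i) $ k = (- (s i \<and>\<^sub>A \<eta>)) $ k" for k
    by (simp add: wedge_s_left wedge_s_right eps_swap[of _ i] sum_negf)
  then show ?thesis by (simp add: vec_eq_iff)
qed

lemma wedge_anticommute: "s i \<and>\<^sub>A s j + s j \<and>\<^sub>A s i = 0"
  by (simp add: wedge_anticommute_s[of "s i" j])

lemma wedge_0_left: "0 \<and>\<^sub>A \<eta> = 0"
  by (simp add: wedge_def)

lemma lift_wedge:
  fixes j k :: 3
  shows "lift (s j \<and>\<^sub>A s k)
    = (of_cplx (1/2) *s (s j \<otimes>\<^sub>A s k - s k \<otimes>\<^sub>A s j) :: 'a::complex_star_algebra ^ (3 \<times> 3))"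
proof -
  define b :: "3 \<Rightarrow> 3 \<Rightarrow> 'a ^ (3 \<times> 3)" where
    "b j k = of_cplx (1/2) *s (s j \<otimes>\<^sub>A s k - s k \<otimes>\<^sub>A s j)" for j k
  have neg: "b k j = - b j k" for j k
    unfolding b_def by (simp add: vec_eq_iff algebra_simps)
  have diag: "b j j = 0" for j
    unfolding b_def by (simp add: vec_eq_iff)
  have m: "- 1 *s u = - u" for u :: "'a ^ (3 \<times> 3)"
    by (simp add: vec_eq_iff)
  have "lift (s j \<and>\<^sub>A s k) = eps j k 1 *s b 2 3 + (eps j k 2 *s b 3 1 + eps j k 3 *s b 1 2)"
    unfolding lift_def wedge_s_component b_def by simp
  also have "\<dots> = b j k"
    using three_cases[of j] three_cases[of k]
    by (elim disjE)
      (simp_all add: eps_def m diag neg[of 1 2] neg[of 2 3] neg[of 3 1])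
  finally show ?thesis unfolding b_def .
qed

lemma pairing_s:
  "pairing g (s i \<otimes>\<^sub>A s j) = of_cplx (complex_of_real (matrix_inv g $ i $ j))"
  unfolding pairing_def
  by (subst sum.remove[of _ i], simp, simp, subst sum.remove[of _ j])
    (auto simp: tens_def bvec_component intro!: sum.neutral)

lemma pairing_add: "pairing g (T + T') = pairing g T + pairing g T'"
  by (simp add: pairing_def distrib_right sum.distrib)

lemma pairing_smult: "pairing g (a *s T) = a * pairing g T"
  by (simp add: pairing_def sum_distrib_left mult.assoc)

lemma pairing_rsmult: "pairing g (T s* a) = pairing g T * a"
  by (simp add: pairing_def rsmult_def sum_distrib_right of_cplx_mult_right mult_scaleC_left)

lemma d1_add:
  assumes "fuzzy_sphere lam x" "lam \<noteq> 0"
  shows "d1 x (\<omega> + \<omega>') = d1 x \<omega> + d1 x \<omega>'"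
  using d0_derivation(1)[OF assms] unfolding derivation_def
  by (simp add: d1_def wedge_add_left vec.scale_left_distrib sum.distrib algebra_simps)

lemma d1_smult:
  assumes "fuzzy_sphere lam x" "lam \<noteq> 0"
  shows "d1 x (a *s \<omega>) = d0 x a \<and>\<^sub>A \<omega> + a *s d1 x \<omega>"
proof -
  have "d1 x (a *s \<omega>) = (\<Sum>i\<in>UNIV. d0 x a \<and>\<^sub>A (\<omega> $ i *s s i)
      + a *s (d0 x (\<omega> $ i) \<and>\<^sub>A s i + \<omega> $ i *s d_s i))"
    using d0_derivation(1)[OF assms] unfolding derivation_def
    by (simp add: d1_def wedge_add_left wedge_balanced wedge_smult)
      (simp add: vec_eq_iff algebra_simps)
  also have "\<dots> = d0 x a \<and>\<^sub>A (\<Sum>i\<in>UNIV. \<omega> $ i *s s i) + a *s d1 x \<omega>"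
    by (simp add: sum.distrib additive_sum[of "(\<and>\<^sub>A) _", OF wedge_add_right] d1_def
        additive_sum[of "(*s) a"] vec_eq_iff sum_component sum_distrib_left algebra_simps)
  finally show ?thesis by (simp flip: bvec_expansion)
qed

lemma d_s_central:
  fixes a :: "'a::complex_star_algebra"
  shows "a *s d_s i = d_s i s* a"
proof -
  have "d_s i $ k * a = a * d_s i $ k" for k
  proof -
    let ?z = "\<Sum>j\<in>UNIV. \<Sum>l\<in>UNIV. eps i j l * eps j l k :: 'a"
    have "eps i j l * eps j l k * a = a * (eps i j l * eps j l k)" for j l
    proof -
      have "eps i j l * eps j l k * a = eps i j l * a * eps j l k"
        by (simp only: mult.assoc eps_central[of j l k a])
      then show ?thesis by (simp only: eps_central[of i j l a] mult.assoc)
    qed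
    then have "?z * a = a * ?z"
      by (simp only: sum_distrib_left sum_distrib_right)
    then have "(of_cplx (- 1/2) * ?z) * a = a * (of_cplx (- 1/2) * ?z)"
      by (simp only: of_cplx_mult_left mult_scaleC_left mult_scaleC_right)
    moreover have "d_s i $ k = of_cplx (- 1/2) * ?z"
      by (simp only: d_s_def vector_smult_component sum_component wedge_s_component)
    ultimately show ?thesis by simp
  qed
  then show ?thesis by (simp add: vec_eq_iff rsmult_def)
qed

lemma d1_rsmult:
  assumes "fuzzy_sphere lam x" "lam \<noteq> 0"
  shows "d1 x (\<omega> s* a) = d1 x \<omega> s* a - \<omega> \<and>\<^sub>A d0 x a"
proof -
  have 1: "(\<eta> s* a) \<and>\<^sub>A s i = (\<eta> \<and>\<^sub>A s i) s* a" for \<eta> i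
    by (simp add: wedge_balanced bvec_central wedge_rsmult)
  have 2: "(b *s d0 x a) \<and>\<^sub>A s i = - ((b *s s i) \<and>\<^sub>A d0 x a)" for b i
    by (simp add: wedge_smult wedge_anticommute_s[of "d0 x a"])
  have 3: "(b * a) *s d_s i = (b *s d_s i) s* a" for b i
    using d_s_central[of a i] by (simp add: vec_eq_iff rsmult_def mult.assoc)
  have "d1 x (\<omega> s* a) = (\<Sum>i\<in>UNIV. (d0 x (\<omega> $ i) \<and>\<^sub>A s i + \<omega> $ i *s d_s i) s* a
      - (\<omega> $ i *s s i) \<and>\<^sub>A d0 x a)"
  proof -
    have "d0 x ((\<omega> s* a) $ i) = d0 x (\<omega> $ i) s* a + \<omega> $ i *s d0 x a" for i
      using d0_derivation(1)[OF assms] unfolding derivation_def by (simp add: rsmult_def)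
    then show ?thesis
      unfolding d1_def
      by (simp add: wedge_add_left 1 2) (simp add: rsmult_def 3 vec_eq_iff algebra_simps)
  qed
  also have "\<dots> = d1 x \<omega> s* a - (\<Sum>i\<in>UNIV. \<omega> $ i *s s i) \<and>\<^sub>A d0 x a"
    by (simp add: sum_subtractf additive_sum[of "\<lambda>\<omega>. \<omega> \<and>\<^sub>A _", OF wedge_add_left] d1_def
        vec_eq_iff sum_component sum_distrib_right rsmult_def)
  finally show ?thesis by (simp flip: bvec_expansion)
qed

lemma d1_s:
  assumes "fuzzy_sphere lam x" "lam \<noteq> 0"
  shows "d1 x (s i) = d_s i"
proof -
  have "d0 x (s i $ j) = 0" for j
    using derivation_0_1[OF d0_derivation(1)[OF assms]] by (simp add: bvec_component)
  then have "d1 x (s i) = (\<Sum>j\<in>UNIV. s i $ j *s d_s j)"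
    by (simp add: d1_def wedge_0_left)
  also have "\<dots> = d_s i"
    unfolding bvec_component by (subst sum.remove[of _ i]) auto
  finally show ?thesis .
qed

lemma wedge_tens_add_left: "wedge_tens (\<omega> + \<omega>') T = wedge_tens \<omega> T + wedge_tens \<omega>' T"
  by (simp add: wedge_tens_def tens_map_def wedge_add_left tens_add_left sum.distrib)

lemma wedge_tens_add_right: "wedge_tens \<omega> (T + T') = wedge_tens \<omega> T + wedge_tens \<omega> T'"
  by (simp add: wedge_tens_def tens_map_def vec.scale_left_distrib wedge_add_right tens_add_left
      sum.distrib)

lemma wedge_tens_balanced: "wedge_tens (\<omega> s* a) T = wedge_tens \<omega> (a *s T)"
  by (simp add: wedge_tens_def tens_map_def wedge_balanced vec.scale_scale)

lemma wedge_tens_tens: "wedge_tens \<omega> (\<eta> \<otimes>\<^sub>A \<zeta>) = (\<omega> \<and>\<^sub>A \<eta>) \<otimes>\<^sub>A \<zeta>"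
  unfolding wedge_tens_def
  by (subst tens_map_tens) (simp_all add: wedge_add_right wedge_rsmult)

lemma d_nabla_tens:
  assumes "fuzzy_sphere lam x" "lam \<noteq> 0" "left_connection x nabla"
  shows "d_nabla x nabla (\<omega> \<otimes>\<^sub>A \<eta>) = d1 x \<omega> \<otimes>\<^sub>A \<eta> - wedge_tens \<omega> (nabla \<eta>)"
proof -
  have n: "nabla (\<eta> + \<eta>') = nabla \<eta> + nabla \<eta>'"
    "nabla (a *s \<eta>) = d0 x a \<otimes>\<^sub>A \<eta> + a *s nabla \<eta>" for \<eta> \<eta>' a
    using assms(3) unfolding left_connection_def by blast+
  have sub: "(\<theta> - \<theta>') \<otimes>\<^sub>A \<eta> = \<theta> \<otimes>\<^sub>A \<eta> - \<theta>' \<otimes>\<^sub>A \<eta>" for \<theta> \<theta>' :: "'a form2" and \<eta> :: "'a form1"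
    by (simp add: vec_eq_iff tens_def algebra_simps)
  show ?thesis
    unfolding d_nabla_def
    by (rule balanced_expansion[of "\<lambda>\<omega> \<eta>. d1 x \<omega> \<otimes>\<^sub>A \<eta> - wedge_tens \<omega> (nabla \<eta>)"])
      (simp_all add: n d1_add[OF assms(1,2)] d1_rsmult[OF assms(1,2)] tens_add_left tens_add_right
        wedge_tens_add_left wedge_tens_add_right wedge_tens_balanced wedge_tens_tens
        sub tens_balanced)
qed

lemma left_connection_exists:
  assumes "fuzzy_sphere lam x" "lam \<noteq> 0"
  shows "\<exists>nabla. left_connection x nabla \<and> (\<forall>i. nabla (s i) = N i)"
proof (intro exI conjI allI)
  let ?n = "\<lambda>\<omega>. \<Sum>i\<in>UNIV. d0 x (\<omega> $ i) \<otimes>\<^sub>A s i + \<omega> $ i *s N i"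
  note D = d0_derivation(1)[OF assms]
  have L: "?n (a *s \<omega>) = d0 x a \<otimes>\<^sub>A \<omega> + a *s ?n \<omega>" for a \<omega>
  proof -
    have "?n (a *s \<omega>) = (\<Sum>i\<in>UNIV. d0 x a \<otimes>\<^sub>A (\<omega> $ i *s s i)
        + a *s (d0 x (\<omega> $ i) \<otimes>\<^sub>A s i + \<omega> $ i *s N i))"
      using D unfolding derivation_def
      by (simp add: tens_add_left tens_balanced tens_smult)
        (simp add: vec_eq_iff algebra_simps)
    also have "\<dots> = d0 x a \<otimes>\<^sub>A (\<Sum>i\<in>UNIV. \<omega> $ i *s s i) + a *s ?n \<omega>"
      by (simp add: sum.distrib tens_sum_right vec_eq_iff sum_component sum_distrib_left
          algebra_simps)
    finally show ?thesis by (simp flip: bvec_expansion)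
  qed
  have c: "d0 x (of_cplx c) = 0" for c
    using D derivation_0_1[OF D] unfolding derivation_def of_cplx_def by simp
  show "left_connection x ?n"
    unfolding left_connection_def
  proof (intro conjI allI)
    show "?n (\<omega> + \<omega>') = ?n \<omega> + ?n \<omega>'" for \<omega> \<omega>'
      using D unfolding derivation_def
      by (simp add: tens_add_left vec.scale_left_distrib sum.distrib algebra_simps)
    show "?n (of_cplx c *s \<omega>) = of_cplx c *s ?n \<omega>" for c \<omega>
      using L[of "of_cplx c" \<omega>] by (simp add: c tens_0_left)
    show "?n (a *s \<omega>) = d0 x a \<otimes>\<^sub>A \<omega> + a *s ?n \<omega>" for a \<omega>
      by (rule L)
  qed
  fix i
  have "d0 x (s i $ j) = 0" for j
    using derivation_0_1[OF D] by (simp add: bvec_component)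
  then have "?n (s i) = (\<Sum>j\<in>UNIV. s i $ j *s N j)"
    by (simp add: tens_0_left)
  also have "\<dots> = N i"
    unfolding bvec_component by (subst sum.remove[of _ i]) auto
  finally show "?n (s i) = N i" .
qed

end

theory Submission
  imports Defs
begin

text \<open>All coefficients of \<open>g\<close> and of \<open>\<nabla>s\<^sup>i\<close> are scalars, which \<open>d\<close> kills, so the curvature reduces
  to \<open>ds\<^sup>i = -e\<^sub>i\<close> and a term quadratic in \<open>\<Gamma>\<close>, and \<open>S\<close> is a contraction of real tensors.
  With \<open>h = g\<^sup>-\<^sup>1\<close> and \<open>B = 2g - Tr(g)\<close> one has \<open>\<Gamma>\<^sub>i\<^sub>j\<^sub>k = \<epsilon>\<^sub>i\<^sub>k\<^sub>q B\<^sub>q\<^sub>j\<close>. The trace \<open>\<Gamma>\<^sup>a\<^sub>a\<^sub>k\<close> vanishes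
  because \<open>Bh\<close> is symmetric, and every remaining pair of factors \<open>h\<close> is eliminated by the
  cofactor identity \<open>\<epsilon>\<^sub>q\<^sub>a\<^sub>b h\<^sub>a\<^sub>i h\<^sub>b\<^sub>m = det(h) g\<^sub>r\<^sub>q \<epsilon>\<^sub>r\<^sub>i\<^sub>m\<close>, or cancelled by \<open>g B h = B\<close>. The linear and the quadratic
  contraction both equal \<open>det(h) (4 Tr(g\<^sup>2) - 2 Tr(g)\<^sup>2)\<close>.\<close>

section \<open>Real scalars inside the algebra\<close>

abbreviation (input) of_rl :: "real \<Rightarrow> 'a::complex_star_algebra" where
  "of_rl r \<equiv> of_cplx (complex_of_real r)"

lemma of_cplx_add: "of_cplx (c + c') = of_cplx c + of_cplx c'"
  by (simp add: of_cplx_def scaleC_add_left)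

lemma of_cplx_mult: "of_cplx (c * c') = of_cplx c * of_cplx c'"
  by (simp add: of_cplx_def mult_scaleC_left scaleC_scaleC)

lemma of_cplx_minus: "of_cplx (- c) = - of_cplx c"
  by (simp add: of_cplx_def scaleC_minus_left)

lemma of_cplx_diff: "of_cplx (c - c') = of_cplx c - of_cplx c'"
  using of_cplx_add[of c "- c'"] by (simp add: of_cplx_minus)

lemma of_cplx_0: "of_cplx 0 = 0"
  by (simp add: of_cplx_def scaleC_0_left)

lemma of_cplx_sum: "of_cplx (\<Sum>i\<in>I. f i) = (\<Sum>i\<in>I. of_cplx (f i))"
  by (simp add: of_cplx_def scaleC_sum_left)

text \<open>Puts the signs occurring in \<open>A\<close> in the form \<open>of_rl\<close>, so that
  sums of scalar coefficients can be pulled out of the embedding and evaluated over the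
  reals.\<close>

lemma eps_of_rl: "(eps i j k :: 'a::complex_star_algebra) = of_rl (eps i j k)"
  by (subst eps_of_cplx) (simp add: eps_def)

section \<open>Components of the tensor operations\<close>

lemma mult_bvec_component:
  "a * bvec i $ j = (if j = i then a else 0)" "bvec i $ j * a = (if j = i then a else 0)"
  by (simp_all add: bvec_component)

lemma sum_UNIV_prod: "(\<Sum>q\<in>UNIV. f q) = (\<Sum>i\<in>UNIV. \<Sum>j\<in>UNIV. f (i, j))"
  by (simp add: sum.cartesian_product flip: UNIV_Times_UNIV)

lemma sum_tens_component:
  "(\<Sum>i\<in>UNIV. \<Sum>j\<in>UNIV. c i j *s (bvec i \<otimes>\<^sub>A bvec j)) $ (k, l) = c k l"
proof -
  have "(\<Sum>j\<in>UNIV. c i j * (bvec i $ k * bvec j $ l)) = (if k = i then c i l else 0)" for i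
  proof -
    have "(\<Sum>j\<in>UNIV. c i j * (bvec i $ k * bvec j $ l))
      = (\<Sum>j\<in>UNIV. if l = j then if k = i then c i j else 0 else 0)"
      by (intro sum.cong refl) (auto simp: bvec_component)
    then show ?thesis by simp
  qed
  then show ?thesis
    by (simp add: sum_component tens_def)
qed

text \<open>The coefficient \<open>T $ (i, j)\<close> comes out of the left factor because that
  factor carries the identity; \<open>h\<close> meets basis vectors only.\<close>

lemma tens_map_id_component:
  "tens_map id h T $ (i, q) = (\<Sum>j\<in>UNIV. T $ (i, j) * h (bvec j) $ q)"
proof -
  have "tens_map id h T $ (i, q)
      = (\<Sum>k\<in>UNIV. if i = k then \<Sum>j\<in>UNIV. T $ (k, j) * h (bvec j) $ q else 0)"
    unfolding tens_map_def sum_component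
  proof (rule sum.cong[OF refl])
    fix k
    show "(\<Sum>j\<in>UNIV. (id (T $ (k, j) *s bvec k) \<otimes>\<^sub>A h (bvec j)) $ (i, q))
      = (if i = k then \<Sum>j\<in>UNIV. T $ (k, j) * h (bvec j) $ q else 0)"
      by (cases "i = k") (simp_all add: tens_def mult_bvec_component)
  qed
  then show ?thesis by simp
qed

lemma tens_map_component_id:
  "tens_map f id T $ (p, j) = (\<Sum>i\<in>UNIV. f (T $ (i, j) *s bvec i) $ p)"
  by (simp add: tens_map_def sum_component tens_def mult_bvec_component)

lemma tens_map_A_component:
  "tens_map_A f T $ j = (\<Sum>i\<in>UNIV. f (T $ (i, j) *s bvec i))"
  by (simp add: tens_map_A_def sum_component mult_bvec_component)

text \<open>The basis 2-form with index \<open>p\<close> is the wedge of the two other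
  \<open>s\<close> in cyclic order, so the antisymmetrised lift has coefficients 1/2 times
  epsilon.\<close>

lemma lift_component:
  "lift (c *s bvec p) $ (i, j) = c * (of_cplx (1/2) * eps p i j)"
  using three_cases[of p] three_cases[of i] three_cases[of j]
  by (elim disjE) (simp_all add: lift_def eps_def tens_def bvec_component)

lemma pairing_bvec:
  "pairing g (c *s bvec (i, j)) = c * of_rl (matrix_inv g $ i $ j)"
proof -
  have "pairing g (c *s bvec (i, j)) = (\<Sum>k\<in>UNIV. if i = k then
      \<Sum>l\<in>UNIV. if j = l then c * of_rl (matrix_inv g $ i $ j) else 0 else 0)"
    unfolding pairing_def
  proof (rule sum.cong[OF refl])
    fix k
    have "(\<Sum>l\<in>UNIV. (c *s bvec (i, j)) $ (k, l) * of_rl (matrix_inv g $ k $ l))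
      = (\<Sum>l\<in>UNIV. if j = l then if i = k then c * of_rl (matrix_inv g $ i $ j) else 0 else 0)"
      by (intro sum.cong refl) (auto simp: bvec_component)
    then show "(\<Sum>l\<in>UNIV. (c *s bvec (i, j)) $ (k, l) * of_rl (matrix_inv g $ k $ l))
      = (if i = k then \<Sum>l\<in>UNIV. if j = l then c * of_rl (matrix_inv g $ i $ j) else 0 else 0)"
      by simp
  qed
  then show ?thesis by simp
qed

lemma metric_component: "metric g $ (i, j) = of_rl (g $ i $ j)"
  unfolding metric_def by (rule sum_tens_component)

lemma reassoc_component: "reassoc T $ ((i, j), (k, l)) = T $ (i, (j, k), l)"
  by (simp add: reassoc_def)

section \<open>Curvature in components\<close>

lemma sum_eps_eps: "(\<Sum>j\<in>UNIV. \<Sum>l\<in>UNIV. eps i j l * eps j l p) = (if i = p then 2 else (0::real))"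
  using three_cases[of p] three_cases[of i]
  by (elim disjE) (simp_all add: sum_3 eps_def)

text \<open>Contracting two epsilons over two indices gives 2 delta, which the factor -1/2 in
  \<open>d_s\<close> turns into -1.\<close>

lemma d_s_component: "d_s i $ p = - (if i = p then 1 else 0)"
proof -
  have "d_s i $ p = of_cplx (- 1/2) * of_rl (\<Sum>j\<in>UNIV. \<Sum>l\<in>UNIV. eps i j l * eps j l p)"
    by (simp only: d_s_def vector_smult_component sum_component wedge_s_component of_real_sum
        of_real_mult of_cplx_sum of_cplx_mult eps_of_rl)
  also have "\<dots> = - (if i = p then 1 else 0)"
    unfolding sum_eps_eps
    by (simp add: of_cplx_mult_left)
      (simp add: of_cplx_def scaleC_scaleC scaleC_minus_left scaleC_one scaleC_0_left scaleC_0_right)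
  finally show ?thesis .
qed

lemma d0_of_cplx:
  assumes "fuzzy_sphere lam x" "lam \<noteq> 0"
  shows "d0 x (of_cplx c) = 0"
  using d0_derivation(1)[OF assms] derivation_0_1[OF d0_derivation(1)[OF assms]]
  unfolding derivation_def of_cplx_def by simp

lemma wedge_tens_component:
  "wedge_tens (a *s s i) T $ (p, m) = (\<Sum>l\<in>UNIV. a * T $ (l, m) * eps i l p)"
proof -
  have "(s i \<and>\<^sub>A (c *s bvec l)) $ p = c * eps i l p" for c :: 'a and l
  proof -
    have "(s i \<and>\<^sub>A (c *s bvec l)) $ p = (\<Sum>j\<in>UNIV. if l = j then c * eps i j p else 0)"
      unfolding wedge_s_left by (intro sum.cong refl) (auto simp: bvec_component)
    then show ?thesis by simp
  qed
  then show ?thesis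
    by (simp add: wedge_tens_def tens_map_component_id wedge_smult mult.assoc)
qed

text \<open>The coefficients \<open>N\<close> are scalars, hence killed by \<open>d0\<close>. The
  derivative therefore hits only the basis forms and contributes \<open>- N i p m\<close>; the
  quadratic term is the wedge of s^j with nabla s^k.\<close>

lemma curvature_component:
  fixes nabla :: "'a::complex_star_algebra form1 \<Rightarrow> 'a ^ (3 \<times> 3)"
  assumes A: "fuzzy_sphere lam x" "lam \<noteq> 0"
    and N: "\<And>i j k. nabla (s i) $ (j, k) = of_rl (N i j k)"
  shows "curvature x nabla (s i) $ (p, m)
    = of_rl (- N i p m - (\<Sum>j\<in>UNIV. \<Sum>k\<in>UNIV. \<Sum>l\<in>UNIV. N i j k * N k l m * eps j l p))"
proof -
  \<comment> \<open>The contribution of \<open>d_s j\<close> is kept as a delta under the sums, so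
    that both terms can be matched summand by summand; the delta is collapsed afterwards.\<close>
  have "curvature x nabla (s i) $ (p, m) = (\<Sum>j\<in>UNIV. \<Sum>k\<in>UNIV.
      of_rl (- (if j = p \<and> k = m then N i p m else 0)
        - (\<Sum>l\<in>UNIV. N i j k * N k l m * eps j l p)))"
    unfolding curvature_def d_nabla_def
    by (auto simp: sum_component N wedge_tens_component d1_smult[OF A] d1_s[OF A]
      d0_of_cplx[OF A] wedge_0_left tens_def bvec_component d_s_component
      of_cplx_add of_cplx_sum of_cplx_mult of_cplx_minus of_cplx_diff eps_of_rl of_cplx_0
      simp flip: sum_negf intro!: sum.cong)
  also have "\<dots> = of_rl (\<Sum>j\<in>UNIV. \<Sum>k\<in>UNIV.
      - (if j = p \<and> k = m then N i p m else 0)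
        - (\<Sum>l\<in>UNIV. N i j k * N k l m * eps j l p))"
    by (simp only: of_cplx_sum of_real_sum)
  also have "(\<Sum>j\<in>UNIV. \<Sum>k\<in>UNIV.
      - (if j = p \<and> k = m then N i p m else 0)
        - (\<Sum>l\<in>UNIV. N i j k * N k l m * eps j l p))
     = - (\<Sum>j\<in>UNIV. if p = j then \<Sum>k\<in>UNIV. if m = k then N i p m else 0 else 0)
        - (\<Sum>j\<in>UNIV. \<Sum>k\<in>UNIV. \<Sum>l\<in>UNIV. N i j k * N k l m * eps j l p)"
    unfolding sum_subtractf sum_negf
    by (intro arg_cong2[where f="(-)"] arg_cong[where f=uminus] sum.cong refl) auto
  finally show ?thesis by simp
qed

section \<open>The inverse metric and the Ricci tensor\<close>

lemma matrix_inv_inverse: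
  assumes "invertible A"
  shows "A ** matrix_inv A = mat 1" "matrix_inv A ** A = mat 1"
  using someI_ex[of "\<lambda>A'. A ** A' = mat 1 \<and> A' ** A = mat 1"] assms
  unfolding matrix_inv_def invertible_def by auto

text \<open>Transposing g g^-1 = 1 shows that the transposed inverse is a left inverse of g, and
  such an inverse is unique.\<close>

lemma matrix_inv_symmetric:
  fixes g :: "real ^ 'n ^ 'n"
  assumes "transpose g = g" "invertible g"
  shows "transpose (matrix_inv g) = matrix_inv g"
proof -
  have "transpose (matrix_inv g) ** g = mat 1"
    using matrix_inv_inverse(1)[OF assms(2)] assms(1)
    by (metis matrix_transpose_mul transpose_mat)
  then show ?thesis
    by (metis assms(2) matrix_inv_inverse(1) matrix_mul_assoc matrix_mul_lid matrix_mul_rid)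
qed

text \<open>The pairing contracts the first leg \<open>i\<close> of the metric with the first leg
  \<open>a\<close> of the lifted 2-form. Metric and inverse metric then cancel to a delta, leaving
  the contraction of \<open>K\<close> with epsilon; the factor 1/2 is that of the lift.\<close>

lemma ricci_component:
  fixes nabla :: "'a::complex_star_algebra form1 \<Rightarrow> 'a ^ (3 \<times> 3)"
  assumes g: "transpose g = g" "invertible g"
    and K: "\<And>i p m. curvature x nabla (s i) $ (p, m) = of_rl (K i p m)"
  shows "ricci x g nabla $ (b, m)
    = of_rl (1/2 * (\<Sum>a\<in>UNIV. \<Sum>p\<in>UNIV. eps p a b * K a p m))"
proof -
  let ?h = "matrix_inv g"
  have gs: "g $ i $ j = g $ j $ i" for i j

  proof -
    have "g $ i $ j = transpose g $ i $ j" by (simp only: g(1))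
    then show ?thesis by (simp add: transpose_def)
  qed
  have hg: "(\<Sum>i\<in>UNIV. g $ i $ j * ?h $ i $ a) = (if j = a then 1 else 0)" for j a
  proof -
    have "(g ** ?h) $ j $ a = (if j = a then 1 else 0)"
      using g(2) by (simp add: matrix_inv_inverse mat_def)
    then show ?thesis unfolding matrix_matrix_mult_def by (simp add: gs[of j])
  qed
  define T where "T = tens_map id (curvature x nabla) (metric g)"
  define U where "U = tens_map id (tens_map lift id) T"
  have T: "T $ (i, (p, m)) = of_rl (\<Sum>j\<in>UNIV. g $ i $ j * K j p m)" for i p m
    unfolding T_def tens_map_id_component metric_component K
    by (simp add: of_cplx_sum of_cplx_mult)
  have "tens_map lift id W $ ((a, b), m) = (\<Sum>p\<in>UNIV. W $ (p, m) * of_rl (1/2 * eps p a b))"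
    for W :: "'a ^ (3 \<times> 3)" and a b m
    unfolding tens_map_component_id lift_component of_real_mult of_cplx_mult eps_of_rl by simp
  note lift = this
  have "U $ (i, (a, b), m) = (\<Sum>p\<in>UNIV. T $ (i, (p, m)) * of_rl (1/2 * eps p a b))" for i a b m
  proof -
    have "U $ (i, (a, b), m)
      = (\<Sum>q\<in>UNIV. \<Sum>n\<in>UNIV. if m = n then T $ (i, (q, n)) * of_rl (1/2 * eps q a b) else 0)"
      unfolding U_def tens_map_id_component sum_UNIV_prod lift
    proof (intro sum.cong refl)
      fix q n :: 3
      have "(\<Sum>p\<in>UNIV. bvec (q, n) $ (p, m) * of_rl (1/2 * eps p a b))
        = (\<Sum>p\<in>UNIV. if q = p then if m = n then of_rl (1/2 * eps p a b) else 0 else (0::'a))"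
        by (intro sum.cong refl) (auto simp: bvec_component)
      then show "T $ (i, (q, n)) * (\<Sum>p\<in>UNIV. bvec (q, n) $ (p, m) * of_rl (1/2 * eps p a b))
        = (if m = n then T $ (i, (q, n)) * of_rl (1/2 * eps q a b) else 0)"
        by simp
    qed
    then show ?thesis by simp
  qed
  then have U: "U $ (i, (a, b), m) = of_rl (\<Sum>p\<in>UNIV.
      (\<Sum>j\<in>UNIV. g $ i $ j * K j p m) * (1/2 * eps p a b))" for i a b m
    by (simp only: vec_lambda_beta T of_cplx_sum of_cplx_mult of_real_sum of_real_mult)
  have "ricci x g nabla $ (b, m) = (\<Sum>ia\<in>UNIV. case ia of (i, a) \<Rightarrow> of_rl (
     (\<Sum>p\<in>UNIV. (\<Sum>j\<in>UNIV. g $ i $ j * K j p m) * (1/2 * eps p a b)) * ?h $ i $ a))"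
    unfolding ricci_def tens_map_A_component T_def[symmetric] U_def[symmetric]
  proof (intro sum.cong refl)
    fix q :: "3 \<times> 3"
    obtain i a where q: "q = (i, a)" by (cases q)
    show "pairing g (reassoc U $ (q, b, m) *s bvec q) = (case q of (i, a) \<Rightarrow> of_rl (
     (\<Sum>p\<in>UNIV. (\<Sum>j\<in>UNIV. g $ i $ j * K j p m) * (1/2 * eps p a b)) * ?h $ i $ a))"
      unfolding q pairing_bvec reassoc_component U prod.case of_real_mult[of _ "?h $ i $ a"] of_cplx_mult ..
  qed
  also have "\<dots> = of_rl (\<Sum>i\<in>UNIV. \<Sum>a\<in>UNIV.
     (\<Sum>p\<in>UNIV. (\<Sum>j\<in>UNIV. g $ i $ j * K j p m) * (1/2 * eps p a b)) * ?h $ i $ a)"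
    by (simp only: sum_UNIV_prod prod.case of_cplx_sum of_real_sum)
  \<comment> \<open>Three swaps move the sum over \<open>i\<close> innermost, where
    \<open>hg\<close> evaluates it.\<close>
  also have "(\<Sum>i\<in>UNIV. \<Sum>a\<in>UNIV.
     (\<Sum>p\<in>UNIV. (\<Sum>j\<in>UNIV. g $ i $ j * K j p m) * (1/2 * eps p a b)) * ?h $ i $ a)
    = (\<Sum>a\<in>UNIV. \<Sum>p\<in>UNIV. \<Sum>j\<in>UNIV.
       (\<Sum>i\<in>UNIV. g $ i $ j * ?h $ i $ a) * (K j p m * (1/2 * eps p a b)))"
    unfolding sum_distrib_right sum_distrib_left
    by (rule trans[OF sum.swap], rule sum.cong[OF refl], rule trans[OF sum.swap],
        rule sum.cong[OF refl], rule trans[OF sum.swap]) (simp add: mult_ac)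
  also have "\<dots> = 1/2 * (\<Sum>a\<in>UNIV. \<Sum>p\<in>UNIV. eps p a b * K a p m)"
  proof -
    have "(\<Sum>j\<in>UNIV. (if j = a then 1 else 0) * (K j p m * (1/2 * eps p a b)))
        = 1/2 * (eps p a b * K a p m)" for a p
    proof -
      have "(\<Sum>j\<in>UNIV. (if j = a then 1 else 0) * (K j p m * (1/2 * eps p a b)))
          = (\<Sum>j\<in>UNIV. if j = a then 1/2 * (eps p a b * K j p m) else 0)"
        by (intro sum.cong refl) simp
      then show ?thesis by simp
    qed
    then show ?thesis
      unfolding hg by (simp only: sum_distrib_left)
  qed
  finally show ?thesis .
qed


section \<open>Epsilon identities and the contraction of real tensors\<close>

lemma sum_eps_det:
  fixes h :: "real ^ 3 ^ 3"
  shows "(\<Sum>p\<in>UNIV. \<Sum>a\<in>UNIV. \<Sum>b\<in>UNIV. eps p a b * h $ p $ r * h $ a $ i * h $ b $ m)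
    = det h * eps r i m"
  \<comment> \<open>For distinct \<open>r\<close>, \<open>i\<close>, \<open>m\<close> this is the
    Leibniz formula with permuted columns; for a repeated column both sides vanish.\<close>
  using three_cases[of r] three_cases[of i] three_cases[of m]
  by (elim disjE) (simp_all add: sum_3 eps_def det_3 algebra_simps)

text \<open>The 2x2 minors of an invertible matrix are, up to sign, its determinant times the
  entries of its inverse. Contracting \<open>sum_eps_det\<close> with \<open>g\<close> over
  \<open>r\<close> cancels the third factor \<open>h\<close>. The identity trades two factors
  \<open>h\<close> for \<open>det h\<close> and one factor \<open>g\<close>.\<close>

lemma sum_eps_cofactor:
  fixes g h :: "real ^ 3 ^ 3"
  assumes "h ** g = mat 1"
  shows "(\<Sum>a\<in>UNIV. \<Sum>b\<in>UNIV. eps q a b * h $ a $ i * h $ b $ m)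
    = det h * (\<Sum>r\<in>UNIV. g $ r $ q * eps r i m)"
proof -
  define c where "c p = (\<Sum>a\<in>UNIV. \<Sum>b\<in>UNIV. eps p a b * h $ a $ i * h $ b $ m)" for p
  have "(\<Sum>p\<in>UNIV. h $ p $ r * c p) = det h * eps r i m" for r
    unfolding sum_eps_det[symmetric] c_def by (simp add: sum_distrib_left mult_ac)
  then have "det h * (\<Sum>r\<in>UNIV. g $ r $ q * eps r i m)
      = (\<Sum>r\<in>UNIV. g $ r $ q * (\<Sum>p\<in>UNIV. h $ p $ r * c p))"
    by (simp add: sum_distrib_left mult_ac)
  also have "\<dots> = (\<Sum>p\<in>UNIV. (h ** g) $ p $ q * c p)"
    unfolding matrix_matrix_mult_def by (simp add: sum_3 algebra_simps)
  also have "\<dots> = c q"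
    by (simp add: assms mat_def if_distrib[of "\<lambda>x. x * _"] cong: if_cong)
  finally show ?thesis unfolding c_def by simp
qed

lemma matrix_diff_ldistrib: "A ** (B - C) = A ** B - A ** (C :: 'b::ring_1 ^ 'n ^ 'm)"
  by (simp add: vec_eq_iff matrix_matrix_mult_def sum_subtractf algebra_simps)

lemma matrix_diff_rdistrib: "(A - B) ** C = A ** C - B ** (C :: 'b::ring_1 ^ 'n ^ 'm)"
  by (simp add: vec_eq_iff matrix_matrix_mult_def sum_subtractf algebra_simps)

text \<open>With coefficients -1/2 Gamma for the connection, the bracket is four times the curvature
  coefficient; this scaling avoids fractions. The linear and the quadratic contraction have the same
  value, so their combination 2L - L is L.\<close>

lemma levi_civita_contraction:
  fixes g h :: "real ^ 3 ^ 3" and \<Gamma> :: "3 \<Rightarrow> 3 \<Rightarrow> 3 \<Rightarrow> real"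
  assumes gt: "transpose g = g" and ht: "transpose h = h"
    and gh: "g ** h = mat 1" and hg: "h ** g = mat 1"
    and \<Gamma>: "\<And>i j k. (\<Sum>m\<in>UNIV. g $ i $ m * \<Gamma> m j k)
              = 2 * (\<Sum>m\<in>UNIV. eps i k m * g $ m $ j) + trace g * eps i j k"
  shows "(\<Sum>b\<in>UNIV. \<Sum>m\<in>UNIV. (\<Sum>a\<in>UNIV. \<Sum>p\<in>UNIV. eps p a b * (2 * \<Gamma> a p m
      - (\<Sum>j\<in>UNIV. \<Sum>k\<in>UNIV. \<Sum>l\<in>UNIV. \<Gamma> a j k * \<Gamma> k l m * eps j l p))) * h $ b $ m)
    = det h * (4 * trace (g ** g) - 2 * (trace g)\<^sup>2)"
proof -
  define B :: "real ^ 3 ^ 3" where "B = 2 *\<^sub>R g - trace g *\<^sub>R mat 1"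
  define W where "W i j k = (\<Sum>q\<in>UNIV. eps i k q * B $ q $ j)" for i j k
  have gs: "g $ i $ j = g $ j $ i" for i j
  proof -
    have "g $ i $ j = transpose g $ i $ j" by (simp only: gt)
    then show ?thesis by (simp add: transpose_def)
  qed
  have hs: "h $ i $ j = h $ j $ i" for i j
  proof -
    have "h $ i $ j = transpose h $ i $ j" by (simp only: ht)
    then show ?thesis by (simp add: transpose_def)
  qed
  have B: "B $ q $ j = 2 * g $ q $ j - (if q = j then trace g else 0)" for q j
    by (simp add: B_def mat_def)
  \<comment> \<open>The trace term of \<open>B\<close> contributes -Tr(g) \<open>eps i k j\<close>,
    which is Tr(g) \<open>eps i j k\<close>; thus \<open>W\<close> is Gamma with its first index
    lowered.\<close>
  have lower: "(\<Sum>m\<in>UNIV. g $ i $ m * \<Gamma> m j k) = W i j k" for i j k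
  proof -
    have "W i j k = (\<Sum>q\<in>UNIV. 2 * (eps i k q * g $ q $ j) - (if q = j then eps i k j * trace g else 0))"
      unfolding W_def B by (intro sum.cong refl) (simp add: algebra_simps)
    also have "\<dots> = 2 * (\<Sum>m\<in>UNIV. eps i k m * g $ m $ j) + trace g * eps i j k"
      unfolding eps_swap[of i j k] eps_cyclic[of j i k, symmetric] eps_cyclic[of k j i, symmetric]
      by (simp add: sum_subtractf sum_distrib_left)
    finally show ?thesis using \<Gamma> by simp
  qed
  have upper: "\<Gamma> a j k = (\<Sum>i\<in>UNIV. h $ a $ i * W i j k)" for a j k
  proof -
    have "(\<Sum>i\<in>UNIV. h $ a $ i * W i j k) = (\<Sum>m\<in>UNIV. (h ** g) $ a $ m * \<Gamma> m j k)"
      unfolding lower[symmetric] matrix_matrix_mult_def by (simp add: sum_3 algebra_simps)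
    then show ?thesis
      by (simp add: hg mat_def if_distrib[of "\<lambda>x. x * _"] cong: if_cong)
  qed
  have Bh: "B ** h = 2 *\<^sub>R mat 1 - trace g *\<^sub>R h"
    unfolding B_def by (simp add: matrix_diff_rdistrib gh flip: scalar_matrix_assoc)
  have "g ** (B ** h) = 2 *\<^sub>R (g ** mat 1) - trace g *\<^sub>R (g ** h)"
    unfolding Bh matrix_diff_ldistrib by (simp only: matrix_scalar_ac scalar_matrix_assoc)
  then have gBh: "g ** (B ** h) = B"
    by (simp add: gh B_def)
  \<comment> \<open>Epsilon is contracted with \<open>B ** h\<close>, which by \<open>Bh\<close> is
    a combination of the identity and the symmetric \<open>h\<close>.\<close>
  have traceless: "(\<Sum>a\<in>UNIV. \<Gamma> a a k) = 0" for k
  proof -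
    have "(\<Sum>a\<in>UNIV. \<Gamma> a a k) = (\<Sum>i\<in>UNIV. \<Sum>q\<in>UNIV. eps i k q * (B ** h) $ q $ i)"
      unfolding upper W_def matrix_matrix_mult_def by (simp add: sum_3 algebra_simps)
    also have "\<dots> = 0"
      using three_cases[of k] hs[of 1 2] hs[of 1 3] hs[of 2 3] unfolding Bh
      by (elim disjE) (simp_all add: sum_3 eps_def mat_def)
    finally show ?thesis .
  qed
  \<comment> \<open>Expanding Gamma by \<open>upper\<close> gives a second \<open>h\<close> beside
    the one carrying \<open>n\<close>. The cofactor identity removes this pair, and the
    \<open>g\<close> it creates cancels the last \<open>h\<close> through
    \<open>gBh\<close>.\<close>
  have raise: "(\<Sum>b\<in>UNIV. \<Sum>k\<in>UNIV. \<Gamma> a b k * h $ k $ n * h $ b $ m)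
      = det h * (\<Sum>r\<in>UNIV. B $ r $ m * eps r a n)" for a m n
  proof -
    have "(\<Sum>k\<in>UNIV. \<Gamma> a b k * h $ k $ n)
        = (\<Sum>q\<in>UNIV. B $ q $ b * (\<Sum>i\<in>UNIV. \<Sum>k\<in>UNIV. eps q i k * h $ i $ a * h $ k $ n))" for b
    proof -
      \<comment> \<open>The symmetry of \<open>h\<close> puts the summed index first, as
        \<open>sum_eps_cofactor\<close> requires.\<close>
      have "\<Gamma> a b k = (\<Sum>i\<in>UNIV. h $ i $ a * W i b k)" for k
        unfolding upper by (intro sum.cong refl arg_cong2[where f="(*)"] hs)
      then show ?thesis
        unfolding W_def by (simp add: sum_3 eps_def algebra_simps)
    qed
    then have "(\<Sum>b\<in>UNIV. \<Sum>k\<in>UNIV. \<Gamma> a b k * h $ k $ n * h $ b $ m)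
        = (\<Sum>b\<in>UNIV. (\<Sum>q\<in>UNIV. B $ q $ b * (det h * (\<Sum>r\<in>UNIV. g $ r $ q * eps r a n))) * h $ b $ m)"
      unfolding sum_eps_cofactor[OF hg] by (simp flip: sum_distrib_right)
    also have "\<dots> = det h * (\<Sum>r\<in>UNIV. (g ** (B ** h)) $ r $ m * eps r a n)"
      unfolding matrix_matrix_mult_def by (simp add: sum_3 algebra_simps)
    finally show ?thesis unfolding gBh .
  qed
  have linear: "(\<Sum>b\<in>UNIV. \<Sum>m\<in>UNIV. \<Sum>a\<in>UNIV. \<Sum>p\<in>UNIV. eps p a b * \<Gamma> a p m * h $ b $ m)
      = det h * (4 * trace (g ** g) - 2 * (trace g)\<^sup>2)"
  proof -
    have "(\<Sum>b\<in>UNIV. \<Sum>m\<in>UNIV. \<Sum>a\<in>UNIV. \<Sum>p\<in>UNIV. eps p a b * \<Gamma> a p m * h $ b $ m)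
      = (\<Sum>p\<in>UNIV. \<Sum>m\<in>UNIV. \<Sum>i\<in>UNIV.
          (\<Sum>a\<in>UNIV. \<Sum>b\<in>UNIV. eps p a b * h $ a $ i * h $ b $ m) * W i p m)"
      unfolding upper by (simp add: sum_3 eps_def algebra_simps)
    also have "\<dots> = det h * (\<Sum>p\<in>UNIV. \<Sum>m\<in>UNIV. \<Sum>i\<in>UNIV.
          (\<Sum>r\<in>UNIV. g $ r $ p * eps r i m) * W i p m)"
      unfolding sum_eps_cofactor[OF hg] by (simp add: sum_distrib_left mult_ac)
    \<comment> \<open>No \<open>h\<close> is left: this is a polynomial identity in the entries of
      the symmetric matrix \<open>g\<close>.\<close>
    also have "(\<Sum>p\<in>UNIV. \<Sum>m\<in>UNIV. \<Sum>i\<in>UNIV. (\<Sum>r\<in>UNIV. g $ r $ p * eps r i m) * W i p m)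
      = 4 * trace (g ** g) - 2 * (trace g)\<^sup>2"
      unfolding W_def B trace_def matrix_matrix_mult_def
      by (simp add: sum_3 eps_def gs[of 2 1] gs[of 3 1] gs[of 3 2] power2_eq_square algebra_simps)
    finally show ?thesis .
  qed
  have quadratic: "(\<Sum>b\<in>UNIV. \<Sum>m\<in>UNIV. \<Sum>a\<in>UNIV. \<Sum>p\<in>UNIV. eps p a b *
      (\<Sum>j\<in>UNIV. \<Sum>k\<in>UNIV. \<Sum>l\<in>UNIV. \<Gamma> a j k * \<Gamma> k l m * eps j l p) * h $ b $ m)
      = det h * (4 * trace (g ** g) - 2 * (trace g)\<^sup>2)"
  proof -
    \<comment> \<open>Summing over \<open>p\<close>, the two epsilons give delta_aj delta_bl -
      delta_al delta_bj. The first product produces the trace that \<open>traceless\<close>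
      kills.\<close>
    have "(\<Sum>a\<in>UNIV. \<Sum>p\<in>UNIV. eps p a b *
      (\<Sum>j\<in>UNIV. \<Sum>k\<in>UNIV. \<Sum>l\<in>UNIV. \<Gamma> a j k * \<Gamma> k l m * eps j l p))
      = (\<Sum>k\<in>UNIV. (\<Sum>a\<in>UNIV. \<Gamma> a a k) * \<Gamma> k b m) - (\<Sum>a\<in>UNIV. \<Sum>k\<in>UNIV. \<Gamma> a b k * \<Gamma> k a m)"
      for b m
      using three_cases[of b]
      by (elim disjE) (simp_all add: sum_3 eps_def algebra_simps)
    then have "(\<Sum>b\<in>UNIV. \<Sum>m\<in>UNIV. \<Sum>a\<in>UNIV. \<Sum>p\<in>UNIV. eps p a b *
      (\<Sum>j\<in>UNIV. \<Sum>k\<in>UNIV. \<Sum>l\<in>UNIV. \<Gamma> a j k * \<Gamma> k l m * eps j l p) * h $ b $ m)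
      = - (\<Sum>b\<in>UNIV. \<Sum>m\<in>UNIV. (\<Sum>a\<in>UNIV. \<Sum>k\<in>UNIV. \<Gamma> a b k * \<Gamma> k a m) * h $ b $ m)"
      unfolding traceless by (simp add: sum_negf flip: sum_distrib_right)
    also have "(\<Sum>b\<in>UNIV. \<Sum>m\<in>UNIV. (\<Sum>a\<in>UNIV. \<Sum>k\<in>UNIV. \<Gamma> a b k * \<Gamma> k a m) * h $ b $ m)
      = (\<Sum>a\<in>UNIV. \<Sum>m\<in>UNIV. \<Sum>n\<in>UNIV.
          (\<Sum>b\<in>UNIV. \<Sum>k\<in>UNIV. \<Gamma> a b k * h $ k $ n * h $ b $ m) * W n a m)"
    proof -
      \<comment> \<open>Only the second Gamma is expanded, with new index \<open>n\<close>. The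
        swaps then bring \<open>b\<close> and \<open>k\<close> innermost, the form in which
        \<open>raise\<close> applies.\<close>
      have "(\<Sum>b\<in>UNIV. \<Sum>m\<in>UNIV. (\<Sum>a\<in>UNIV. \<Sum>k\<in>UNIV. \<Gamma> a b k * \<Gamma> k a m) * h $ b $ m)
        = (\<Sum>b\<in>UNIV. \<Sum>m\<in>UNIV. \<Sum>a\<in>UNIV. \<Sum>k\<in>UNIV. \<Sum>n\<in>UNIV.
            \<Gamma> a b k * h $ k $ n * h $ b $ m * W n a m)"
      proof -
        have "\<Gamma> a b k * \<Gamma> k a m * h $ b $ m
          = (\<Sum>n\<in>UNIV. \<Gamma> a b k * h $ k $ n * h $ b $ m * W n a m)" for a b k m
          unfolding upper[of k a m] by (simp add: sum_distrib_left sum_distrib_right mult_ac)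
        then show ?thesis by (simp only: sum_distrib_right)
      qed
      also have "\<dots> = (\<Sum>m\<in>UNIV. \<Sum>a\<in>UNIV. \<Sum>b\<in>UNIV. \<Sum>k\<in>UNIV. \<Sum>n\<in>UNIV.
            \<Gamma> a b k * h $ k $ n * h $ b $ m * W n a m)"
        by (rule trans[OF sum.swap], rule sum.cong[OF refl], rule sum.swap)
      also have "\<dots> = (\<Sum>m\<in>UNIV. \<Sum>a\<in>UNIV. \<Sum>b\<in>UNIV. \<Sum>n\<in>UNIV. \<Sum>k\<in>UNIV.
            \<Gamma> a b k * h $ k $ n * h $ b $ m * W n a m)"
        by (rule sum.cong[OF refl], rule sum.cong[OF refl], rule sum.cong[OF refl], rule sum.swap)
      also have "\<dots> = (\<Sum>a\<in>UNIV. \<Sum>m\<in>UNIV. \<Sum>n\<in>UNIV. \<Sum>b\<in>UNIV. \<Sum>k\<in>UNIV.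
            \<Gamma> a b k * h $ k $ n * h $ b $ m * W n a m)"
        by (rule trans[OF sum.swap], rule sum.cong[OF refl], rule sum.cong[OF refl], rule sum.swap)
      finally show ?thesis by (simp only: sum_distrib_right)
    qed
    also have "\<dots> = det h * (\<Sum>a\<in>UNIV. \<Sum>m\<in>UNIV. \<Sum>n\<in>UNIV. (\<Sum>r\<in>UNIV. B $ r $ m * eps r a n) * W n a m)"
      unfolding raise by (simp add: sum_distrib_left mult_ac)
    also have "(\<Sum>a\<in>UNIV. \<Sum>m\<in>UNIV. \<Sum>n\<in>UNIV. (\<Sum>r\<in>UNIV. B $ r $ m * eps r a n) * W n a m)
      = 2 * (trace g)\<^sup>2 - 4 * trace (g ** g)"
      unfolding W_def B trace_def matrix_matrix_mult_def
      by (simp add: sum_3 eps_def gs[of 2 1] gs[of 3 1] gs[of 3 2] power2_eq_square algebra_simps)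
    finally show ?thesis by (simp add: algebra_simps)
  qed
  show ?thesis (is "?L = _")
  proof -
    have "?L = 2 * (\<Sum>b\<in>UNIV. \<Sum>m\<in>UNIV. \<Sum>a\<in>UNIV. \<Sum>p\<in>UNIV. eps p a b * \<Gamma> a p m * h $ b $ m)
      - (\<Sum>b\<in>UNIV. \<Sum>m\<in>UNIV. \<Sum>a\<in>UNIV. \<Sum>p\<in>UNIV. eps p a b *
      (\<Sum>j\<in>UNIV. \<Sum>k\<in>UNIV. \<Sum>l\<in>UNIV. \<Gamma> a j k * \<Gamma> k l m * eps j l p) * h $ b $ m)"
    proof -
      \<comment> \<open>Stated for arbitrary \<open>E\<close>, \<open>X\<close>, \<open>Y\<close> so
        that expanding the two sums leaves the inner triple sum untouched.\<close>
      have "(\<Sum>a\<in>UNIV. \<Sum>p\<in>UNIV. E a p * (2 * X a p - Y a p)) * c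
        = 2 * (\<Sum>a\<in>UNIV. \<Sum>p\<in>UNIV. E a p * X a p * c) - (\<Sum>a\<in>UNIV. \<Sum>p\<in>UNIV. E a p * Y a p * c)"
        for E X Y :: "3 \<Rightarrow> 3 \<Rightarrow> real" and c
        by (simp add: sum_3 algebra_simps)
      then show ?thesis
        by (simp only: sum_subtractf sum_distrib_left[of 2])
    qed
    then show ?thesis
      unfolding linear quadratic by (simp add: algebra_simps)
  qed
qed

section \<open>The scalar curvature\<close>

theorem proposition3p5:
  fixes lam :: real
    and x :: "3 \<Rightarrow> 'a::complex_star_algebra"
    and g :: "real ^ 3 ^ 3"
    and \<Gamma> :: "3 \<Rightarrow> 3 \<Rightarrow> 3 \<Rightarrow> real"
    and nabla :: "'a form1 \<Rightarrow> 'a ^ (3 \<times> 3)"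
  assumes lam: "lam \<noteq> 0" "lam \<noteq> 1" "lam \<noteq> - 1"
    and A: "fuzzy_sphere lam x"
    and g_sym: "transpose g = g"
    and g_inv: "invertible g"
    and \<Gamma>: "\<And>i j k. (\<Sum>m\<in>UNIV. g $ i $ m * \<Gamma> m j k)
              = 2 * (\<Sum>m\<in>UNIV. eps i k m * g $ m $ j) + trace g * eps i j k"
    and connection: "left_connection x nabla"
    and nabla_s: "\<And>i. nabla (s i) = (\<Sum>j\<in>UNIV. \<Sum>k\<in>UNIV.
              of_cplx (complex_of_real (- 1/2 * \<Gamma> i j k)) *s (s j \<otimes>\<^sub>A s k))"
  shows "scalar_curvature x g nabla
    = of_cplx (complex_of_real ((1/2 * (trace (g ** g) - 1/2 * (trace g)\<^sup>2)) / det g))"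
proof -
  let ?h = "matrix_inv g"
  define N where "N i j k = - 1/2 * \<Gamma> i j k" for i j k
  define K where "K i p m = - N i p m - (\<Sum>j\<in>UNIV. \<Sum>k\<in>UNIV. \<Sum>l\<in>UNIV. N i j k * N k l m * eps j l p)"
    for i p m
  define R where "R b m = (\<Sum>a\<in>UNIV. \<Sum>p\<in>UNIV. eps p a b * K a p m)" for b m
  have nabla_N: "nabla (s i) $ (j, k) = of_rl (N i j k)" for i j k
    unfolding nabla_s sum_tens_component N_def ..
  \<comment> \<open>Substituting \<open>N\<close> = -1/2 Gamma gives 1/2 for the linear and -1/4 for
    the quadratic term.\<close>
  have K4: "K i p m = 1/4 * (2 * \<Gamma> i p m
      - (\<Sum>j\<in>UNIV. \<Sum>k\<in>UNIV. \<Sum>l\<in>UNIV. \<Gamma> i j k * \<Gamma> k l m * eps j l p))" for i p m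
    unfolding K_def N_def by (simp add: sum_distrib_left right_diff_distrib)
  have "curvature x nabla (s i) $ (p, m) = of_rl (K i p m)" for i p m
    unfolding K_def by (rule curvature_component[OF A lam(1)]) (rule nabla_N)
  then have ricci: "ricci x g nabla $ (b, m) = of_rl (1/2 * R b m)" for b m
    unfolding R_def by (rule ricci_component[OF g_sym g_inv])
  have "det g * det ?h = 1"
    using matrix_inv_inverse(1)[OF g_inv] by (metis det_I det_mul)
  then have det: "det ?h = 1 / det g"
    by (metis mult_cancel_left2 mult_eq_0_iff nonzero_eq_divide_eq mult.commute zero_neq_one)
  have "4 * R b m = (\<Sum>a\<in>UNIV. \<Sum>p\<in>UNIV. eps p a b * (2 * \<Gamma> a p m
      - (\<Sum>j\<in>UNIV. \<Sum>k\<in>UNIV. \<Sum>l\<in>UNIV. \<Gamma> a j k * \<Gamma> k l m * eps j l p)))" for b m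
    unfolding R_def K4 sum_distrib_left[of 4] by (intro sum.cong refl) simp
  then have "(\<Sum>b\<in>UNIV. \<Sum>m\<in>UNIV. 4 * R b m * ?h $ b $ m)
      = det ?h * (4 * trace (g ** g) - 2 * (trace g)\<^sup>2)"
    using levi_civita_contraction[OF g_sym matrix_inv_symmetric[OF g_sym g_inv]
        matrix_inv_inverse[OF g_inv] \<Gamma>] by simp
  \<comment> \<open>The constant 1/8 is the 1/2 of the lift times the 1/4 of
    \<open>K4\<close>.\<close>
  moreover have "(\<Sum>b\<in>UNIV. \<Sum>m\<in>UNIV. 1/2 * R b m * ?h $ b $ m)
      = 1/8 * (\<Sum>b\<in>UNIV. \<Sum>m\<in>UNIV. 4 * R b m * ?h $ b $ m)"
    unfolding sum_distrib_left[of "1/8"] by (intro sum.cong refl) simp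
  \<comment> \<open>At \<open>d = 0\<close> both sides are 0, since division by zero yields
    0.\<close>
  moreover have "1/8 * (1 / d * (4 * t - 2 * u)) = (1/2 * (t - 1/2 * u)) / d" for d t u :: real
    by (cases "d = 0") (simp_all add: field_simps)
  ultimately have "(\<Sum>b\<in>UNIV. \<Sum>m\<in>UNIV. 1/2 * R b m * ?h $ b $ m)
      = (1/2 * (trace (g ** g) - 1/2 * (trace g)\<^sup>2)) / det g"
    by (simp only: det)
  moreover have "scalar_curvature x g nabla = of_rl (\<Sum>b\<in>UNIV. \<Sum>m\<in>UNIV. 1/2 * R b m * ?h $ b $ m)"
    unfolding scalar_curvature_def pairing_def ricci
    by (simp only: of_cplx_sum of_real_sum of_cplx_mult of_real_mult)
  ultimately show ?thesis by simp
qed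

end
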